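(* Let $(E,H,\mu)$ be an abstract Wiener space and let $x\in E\setminus H$. With $q_x$, $E_x$, $(P_t)_{t\ge0}$ and $(U_\alpha)_{\alpha>0}$ as in the context, define $v_0^x:=U_1(q_x^2)$ and, for every $z\in E$, $v_z^x:=v_0^x\circ T_z^{-1}$, where $T_z(y)=y+z$. Then for every $z\in E$ the function $v_z^x$ is a compact Lyapunov function such that $E_x+z=[v_z^x<\infty]$, and each $E_x+z$ is invariant with respect to $(P_t)_{t\ge0}$, i.e. $P_t(1_{E_x+z})=1_{E_x+z}$ for all $t>0$.
   Context: Abstract Wiener space $(E,H,\mu)$: $(H,\langle\cdot,\cdot\rangle)$ is a separable real Hilbert space with norm $|\cdot|$, continuously and densely embedded into a Banach space $(E,\|\cdot\|)$; identifying $H$ with its dual, $E'\subset H\subset E$ continuously and densely; and $\mu$ is a Gaussian probability measure on the Borel $\sigma$-algebra $\mathcal B$ of $E$ such that every $l\in E'$ is, under $\mu$, normally distributed with mean $0$ and variance $|l|^2$ (the $H$-norm of $l$). Write ${}_{E'}\langle l,z\rangle_E=l(z)$. For $t>0$, $\mu_t$ is the image of $\mu$ under $z\mapsto\sqrt t\,z$. For $f\ge0$ $\mathcal B$-measurable, $P_tf(y)=\int_E f(y+w)\,\mu_t(dw)$ for $t>0$, $P_0=\mathrm{Id}$, and $U_\alpha=\int_0^\infty e^{-\alpha t}P_t\,dt$, $\alpha>0$. For $\beta>0$, $\mathcal U_\beta=(U_{\beta+\alpha})_{\alpha>0}$. A $\mathcal B$-measurable $u:E\to[0,\infty]$ is $\mathcal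 U_\beta$-excessive if $\alpha U_{\beta+\alpha}u\le u$ for all $\alpha>0$ and $\lim_{\alpha\to\infty}\alpha U_{\beta+\alpha}u=u$ pointwise. A compact Lyapunov function is a function $v$ which is $\mathcal U_\beta$-excessive (here with $\beta=1$) and such that $[v\le\alpha]$ is relatively compact in $E$ for all $\alpha>0$. Fix $x\in E\setminus H$ (so $\dim H=\infty$). Fix an orthonormal basis $\{e_n^x: n\ge1\}$ of $H$ with $e_n^x\in E'$ for all $n$, which separates the points of $E$ and satisfies ${}_{E'}\langle e_n^x,x\rangle_E\ge 2^{n/2}$ for all $n$ (such a basis exists). Let $\widetilde P_n z=\sum_{k=1}^n {}_{E'}\langle e_k^x,z\rangle_E\,e_k^x$, $z\in E$. Let $(\widetilde Q_n)_{n\ge1}$ be a subsequence of $(\widetilde P_n)_{n\ge1}$, with $Q_n:=\widetilde Q_n|_H$, such that for all $n\ge1$ $$\|\mathrm{Id}_H-Q_n\|_{\mathcal L(H,E)}\le 2^{-n},\qquad \mu(\{z\in E:\|z-\widetilde Q_nz\|>2^{-n}\})\le 2^{-n}$$ (such a subsequence exists), and $\widetilde Q_0:=0$. Define $$q_x(z):=\Big[\sum_{n\ge0}2^n\|\widetilde Q_{n+1}z-\widetilde Q_nz\|^2+\Big(\sum_{n\ge1}2^{-n/2}|{}_{E'}\langle e_n^x,z\rangle_E|\Big)^2\Big]^{1/2},\quad z\in E,$$ and $E_x:=\{z\in E: q_x(z)<\infty\}$. *)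

theory Defs
  imports "HOL-Probability.Probability"
begin

text \<open>The embedding of \<open>H\<close> into \<open>E\<close> is a map \<open>j\<close> from the Hilbert space type to the Banach space
  type. \<open>riesz_rep j l h\<close> says that \<open>l \<in> E'\<close> is identified with \<open>h \<in> H\<close>, that is,
  \<open>l\<close> restricted to \<open>H\<close> is the inner product with \<open>h\<close>. Both \<open>h\<close> and (as \<open>j\<close> has dense range)
  \<open>l\<close> are determined by the other.\<close>

definition riesz_rep ::
  "('h::real_inner \<Rightarrow> 'e::real_normed_vector) \<Rightarrow> ('e \<Rightarrow> real) \<Rightarrow> 'h \<Rightarrow> bool" where
  "riesz_rep j l h \<longleftrightarrow> bounded_linear l \<and> (\<forall>k. l (j k) = h \<bullet> k)"

text \<open>\<open>normal_density\<close> is meaningful only for positive standard deviation; the functional \<open>0\<close>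
  has the degenerate law.\<close>

definition normal_law :: "real \<Rightarrow> real \<Rightarrow> real measure" where
  "normal_law m s = (if s = 0 then return borel m else density lborel (\<lambda>t. ennreal (normal_density m s t)))"

locale abstract_wiener_space = prob_space \<mu>
  for \<mu> :: "'e::banach measure"
    and j :: "'h::{real_inner, polish_space} \<Rightarrow> 'e" +
  assumes sets_mu: "sets \<mu> = sets borel"
    and embedding_bounded_linear: "bounded_linear j"
    and embedding_inj: "inj j"
    and embedding_dense: "closure (range j) = UNIV"
    and gaussian: "bounded_linear l \<Longrightarrow> \<exists>h. riesz_rep j l h \<and> distr \<mu> borel l = normal_law 0 (norm h)"

definition gauss_scaled :: "'e::banach measure \<Rightarrow> real \<Rightarrow> 'e measure" where
  "gauss_scaled \<mu> t = distr \<mu> borel (\<lambda>z. sqrt t *\<^sub>R z)"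

definition semigroup_P :: "'e::banach measure \<Rightarrow> real \<Rightarrow> ('e \<Rightarrow> ennreal) \<Rightarrow> 'e \<Rightarrow> ennreal" where
  "semigroup_P \<mu> t f y = (if t = 0 then f y else (\<integral>\<^sup>+ w. f (y + w) \<partial>gauss_scaled \<mu> t))"

definition resolvent_U :: "'e::banach measure \<Rightarrow> real \<Rightarrow> ('e \<Rightarrow> ennreal) \<Rightarrow> 'e \<Rightarrow> ennreal" where
  "resolvent_U \<mu> \<alpha> f y = (\<integral>\<^sup>+ t\<in>{0..}. (ennreal (exp (- \<alpha> * t)) * semigroup_P \<mu> t f y) \<partial>lborel)"

definition excessive :: "'e::banach measure \<Rightarrow> real \<Rightarrow> ('e \<Rightarrow> ennreal) \<Rightarrow> bool" where
  "excessive \<mu> \<beta> u \<longleftrightarrow>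
     u \<in> borel_measurable borel \<and>
     (\<forall>\<alpha>>0. \<forall>y. ennreal \<alpha> * resolvent_U \<mu> (\<beta> + \<alpha>) u y \<le> u y) \<and>
     (\<forall>y. ((\<lambda>\<alpha>. ennreal \<alpha> * resolvent_U \<mu> (\<beta> + \<alpha>) u y) \<longlongrightarrow> u y) at_top)"

definition compact_lyapunov :: "'e::banach measure \<Rightarrow> real \<Rightarrow> ('e \<Rightarrow> ennreal) \<Rightarrow> bool" where
  "compact_lyapunov \<mu> \<beta> v \<longleftrightarrow>
     excessive \<mu> \<beta> v \<and> (\<forall>\<alpha>>0. compact (closure {y. v y \<le> ennreal \<alpha>}))"

text \<open>For a sequence \<open>e\<close> in \<open>H\<close> with corresponding functionals \<open>l n \<in> E'\<close>
  (indices starting at 1), the map from \<open>E\<close> to \<open>H\<close> given by the \<open>n\<close>-th partial expansion.\<close>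

definition proj_P :: "(nat \<Rightarrow> 'h::real_inner) \<Rightarrow> (nat \<Rightarrow> 'e \<Rightarrow> real) \<Rightarrow> nat \<Rightarrow> 'e \<Rightarrow> 'h" where
  "proj_P e l n z = (\<Sum>k=1..n. l k z *\<^sub>R e k)"

definition ennreal_sqrt :: "ennreal \<Rightarrow> ennreal" where
  "ennreal_sqrt a = (if a = \<infinity> then \<infinity> else ennreal (sqrt (enn2real a)))"

text \<open>\<open>Q n\<close> for \<open>n \<ge> 0\<close> is the sequence of maps from \<open>E\<close> to \<open>H\<close>; the second sum over \<open>n \<ge> 1\<close>
  is indexed by \<open>Suc n\<close>.\<close>

definition q_fun ::
  "('h::real_inner \<Rightarrow> 'e::banach) \<Rightarrow> (nat \<Rightarrow> 'e \<Rightarrow> real) \<Rightarrow> (nat \<Rightarrow> 'e \<Rightarrow> 'h) \<Rightarrow> 'e \<Rightarrow> ennreal" where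
  "q_fun j l Q z = ennreal_sqrt (
     (\<Sum>n. ennreal (2 ^ n * (norm (j (Q (Suc n) z) - j (Q n z)))\<^sup>2)) +
     (\<Sum>n. ennreal (2 powr (- real (Suc n) / 2) * \<bar>l (Suc n) z\<bar>))\<^sup>2)"

definition E_fin :: 
  "('h::real_inner \<Rightarrow> 'e::banach) \<Rightarrow> (nat \<Rightarrow> 'e \<Rightarrow> real) \<Rightarrow> (nat \<Rightarrow> 'e \<Rightarrow> 'h) \<Rightarrow> 'e set" where
  "E_fin j l Q = {z. q_fun j l Q z < \<infinity>}"

definition translation :: "'e::ab_group_add \<Rightarrow> 'e \<Rightarrow> 'e" where
  "translation z y = y + z"

definition v_fun ::
  "'e measure \<Rightarrow> ('h::real_inner \<Rightarrow> 'e::banach) \<Rightarrow> (nat \<Rightarrow> 'e \<Rightarrow> real) \<Rightarrow> (nat \<Rightarrow> 'e \<Rightarrow> 'h) \<Rightarrow>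
    'e \<Rightarrow> 'e \<Rightarrow> ennreal" where
  "v_fun \<mu> j l Q z = resolvent_U \<mu> 1 (\<lambda>y. (q_fun j l Q y)\<^sup>2) \<circ> inv (translation z)"

end

theory Submission
  imports Defs
begin

text \<open>All functions involved factor through the coordinates \<open>l n z\<close>, and by the Cramer--Wold device
  the law of these coordinates under \<open>\<mu>\<close> and under \<open>\<mu> \<Otimes> \<mu>\<close> is determined by characteristic functions.
  This gives \<open>P\<^sub>s P\<^sub>t = P\<^sub>s\<^sub>+\<^sub>t\<close> on such functions and the rotation invariance behind Fernique's
  argument. The latter turns the bound in probability on the increments of \<open>Q n z\<close> into a bound in
  mean square, so \<open>q\<^sup>2\<close> is integrable.

  Since \<open>q\<close> is a seminorm, \<open>q\<^sup>2 (y + a w) \<le> 2 q\<^sup>2 y + 2 a\<^sup>2 q\<^sup>2 w\<close>; integrating this inequality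
  shows that \<open>U\<^sub>1 q\<^sup>2\<close> and \<open>q\<^sup>2\<close> bound each other up to the factor 2 and an additive constant.
  Hence they are finite at the same points, and the sublevel sets of \<open>U\<^sub>1 q\<^sup>2\<close> are
  relatively compact because those of \<open>q\<close> are totally bounded: there \<open>Q n z\<close> converges to
  \<open>z\<close> uniformly and ranges over a bounded subset of a finite-dimensional space. Invariance follows as \<open>q\<close> is
  finite almost everywhere.\<close>

section \<open>Characteristic functions of families of random variables\<close>

text \<open>\<open>Levy_uniqueness\<close> speaks of probability measures. The characteristic
  function at 0 is the total mass, so both measures have the same mass \<open>m\<close>, and
  dividing by \<open>m\<close> reduces to that case. The zero measure cannot be normalised and is
  treated first.\<close>

lemma char_eq_imp_eq_finite_measure:
  fixes M N :: "real measure"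
  assumes "finite_measure M" "finite_measure N"
    and sets: "sets M = sets borel" "sets N = sets borel"
    and char: "\<And>t. char M t = char N t"
  shows "M = N"
proof -
  interpret M: finite_measure M by fact
  interpret N: finite_measure N by fact
  have space: "space M = UNIV" "space N = UNIV"
    using sets_eq_imp_space_eq[OF sets(1)] sets_eq_imp_space_eq[OF sets(2)] by simp_all
  define m where "m = measure M UNIV"
  have mN: "measure N UNIV = m"
    using char[of 0] space by (simp add: char_def m_def)
  have em: "emeasure M UNIV = ennreal m" "emeasure N UNIV = ennreal m"
    using M.emeasure_eq_measure N.emeasure_eq_measure mN m_def by auto
  show ?thesis
  proof (cases "m = 0")
    case True
    have "emeasure M A = 0" "emeasure N A = 0" for A
      using em True emeasure_mono[of A UNIV M] emeasure_mono[of A UNIV N] sets by auto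
    then show ?thesis
      using sets by (intro measure_eqI) auto
  next
    case False
    then have m: "m > 0" by (simp add: m_def zero_less_measure_iff)
    define c where "c = (\<lambda>_::real. ennreal (1 / m))"
    have prob: "real_distribution (density K c)" "char (density K c) t = char K t / m"
      if K: "sets K = sets borel" "space K = UNIV" "emeasure K UNIV = ennreal m" for K t
    proof -
      have [measurable_cong]: "sets K = sets borel" by fact
      have "emeasure (density K c) UNIV = 1"
        using m K by (simp add: emeasure_density c_def nn_integral_cmult ennreal_mult'[symmetric])
      then show "real_distribution (density K c)"
        unfolding real_distribution_def real_distribution_axioms_def
        by (auto intro!: prob_spaceI simp: K)
      have "char (density K c) t = (CLINT x|K. (1 / m) *\<^sub>R iexp (t * x))"
        unfolding char_def c_def using m by (subst integral_density) auto
      then show "char (density K c) t = char K t / m"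
        by (simp add: char_def scaleR_conv_of_real divide_inverse mult.commute)
    qed
    have "density M c = density N c"
      using prob[OF sets(1) space(1) em(1)] prob[OF sets(2) space(2) em(2)] char
      by (intro Levy_uniqueness) auto
    show ?thesis
    proof (rule measure_eqI)
      fix A assume A: "A \<in> sets M"
      have "emeasure M A * ennreal (1 / m) = emeasure N A * ennreal (1 / m)"
        using arg_cong[OF \<open>density M c = density N c\<close>, of "\<lambda>K. emeasure K A"] A sets
        by (simp add: emeasure_density_const c_def mult.commute)
      then have "emeasure M A * (ennreal (1 / m) * ennreal m) = emeasure N A * (ennreal (1 / m) * ennreal m)"
        by (metis mult.assoc)
      then show "emeasure M A = emeasure N A"
        using m by (simp add: ennreal_mult'[symmetric])
    qed (simp add: sets)
  qed
qed

lemma cos_add_conv_iexp: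
  "complex_of_real (cos (u + c)) = (iexp c * iexp u + iexp (- c) * iexp (- u)) / 2"
proof -
  have "iexp c * iexp u + iexp (- c) * iexp (- u) = iexp (u + c) + iexp (- (u + c))"
    by (simp add: exp_add[symmetric] algebra_simps)
  also have "\<dots> = 2 * complex_of_real (cos (u + c))"
    using cos_minus[of "u + c"] sin_minus[of "u + c"] by (simp add: complex_eq_iff Re_exp Im_exp)
  finally show ?thesis by simp
qed

text \<open>The phase \<open>c\<close> gives cosine and sine at once; adding 1 makes the weight nonnegative.\<close>

lemma char_weighted_distr:
  fixes X U :: "'a \<Rightarrow> real" and c :: real
  assumes "finite_measure M" and [measurable]: "X \<in> borel_measurable M" "U \<in> borel_measurable M"
  defines "D \<equiv> distr (density M (\<lambda>x. ennreal (1 + cos (U x + c)))) borel X"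
  shows "finite_measure D"
    and "char D t = (CLINT x|M. iexp (t * X x))
      + (iexp c * (CLINT x|M. iexp (t * X x + U x)) + iexp (- c) * (CLINT x|M. iexp (t * X x - U x))) / 2"
proof -
  interpret M: finite_measure M by fact
  have nonneg: "0 \<le> 1 + cos r" for r :: real
    using cos_ge_minus_one[of r] by linarith
  have int: "integrable M (\<lambda>x. iexp (f x))" if [measurable]: "f \<in> borel_measurable M" for f
    by (rule M.integrable_const_bound[where B = 1]) auto
  have "(\<integral>\<^sup>+ x. ennreal (1 + cos (U x + c)) \<partial>M) \<le> (\<integral>\<^sup>+ x. 2 \<partial>M)"
    by (intro nn_integral_mono) (auto simp flip: ennreal_numeral intro!: ennreal_leI)
  also have "\<dots> < \<infinity>"
    by (simp add: ennreal_mult_less_top M.emeasure_finite ennreal_mult_eq_top_iff less_top[symmetric])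
  finally have "emeasure D (space D) < \<infinity>"
    by (auto simp: D_def emeasure_distr emeasure_density cong: nn_integral_cong)
  then show "finite_measure D"
    by (intro finite_measureI) auto
  have "char D t = (CLINT x|M. (1 + cos (U x + c)) *\<^sub>R iexp (t * X x))"
    unfolding char_def D_def using nonneg
    by (subst integral_distr, simp, simp, subst integral_density) auto
  also have "\<dots> = (CLINT x|M. iexp (t * X x) + (iexp c * iexp (t * X x + U x) + iexp (- c) * iexp (t * X x - U x)) / 2)"
  proof (rule Bochner_Integration.integral_cong[OF refl])
    fix x
    have "(1 + cos (U x + c)) *\<^sub>R iexp (t * X x)
        = iexp (t * X x) + complex_of_real (cos (U x + c)) * iexp (t * X x)"
      by (simp add: scaleR_conv_of_real algebra_simps)
    also have "\<dots> = iexp (t * X x) + (iexp c * (iexp (U x) * iexp (t * X x)) + iexp (- c) * (iexp (- U x) * iexp (t * X x))) / 2"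
      by (simp only: cos_add_conv_iexp) (simp add: field_simps)
    also have "iexp (U x) * iexp (t * X x) = iexp (t * X x + U x)"
      by (simp add: exp_add[symmetric] algebra_simps)
    also have "iexp (- U x) * iexp (t * X x) = iexp (t * X x - U x)"
      by (simp add: exp_add[symmetric] algebra_simps)
    finally show "(1 + cos (U x + c)) *\<^sub>R iexp (t * X x) = iexp (t * X x) + (iexp c * iexp (t * X x + U x) + iexp (- c) * iexp (t * X x - U x)) / 2" .
  qed
  also have "\<dots> = (CLINT x|M. iexp (t * X x))
      + (iexp c * (CLINT x|M. iexp (t * X x + U x)) + iexp (- c) * (CLINT x|M. iexp (t * X x - U x))) / 2"
    by (simp add: int del: of_real_add of_real_mult of_real_diff)
  finally show "char D t = (CLINT x|M. iexp (t * X x))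
      + (iexp c * (CLINT x|M. iexp (t * X x + U x)) + iexp (- c) * (CLINT x|M. iexp (t * X x - U x))) / 2" .
qed

text \<open>This is the induction step of the Cramer-Wold device. The laws of \<open>X\<close> and
  \<open>Y\<close> under the weights built from \<open>1 + cos\<close> have characteristic functions
  that are combinations of the joint ones in \<open>eq\<close>. Hence these laws coincide and can be
  evaluated on \<open>A\<close>, which restricts both measures in the same way.\<close>

lemma restricted_char_eq:
  fixes X U :: "'a \<Rightarrow> real" and Y V :: "'b \<Rightarrow> real"
  assumes "finite_measure M" "finite_measure N"
    and [measurable]: "X \<in> borel_measurable M" "U \<in> borel_measurable M"
      "Y \<in> borel_measurable N" "V \<in> borel_measurable N" "A \<in> sets borel"
    and eq: "\<And>t s. (CLINT x|M. iexp (t * X x + s * U x)) = (CLINT y|N. iexp (t * Y y + s * V y))"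
  shows "(CLINT x|density M (\<lambda>x. indicator A (X x)). iexp (U x))
    = (CLINT y|density N (\<lambda>y. indicator A (Y y)). iexp (V y))"
proof -
  interpret M: finite_measure M by fact
  interpret N: finite_measure N by fact
  have weighted: "(LINT x|M. indicator A (X x) * (1 + cos (s * U x + c)))
      = (LINT y|N. indicator A (Y y) * (1 + cos (s * V y + c)))" for s c
  proof -
    define D where "D = distr (density M (\<lambda>x. ennreal (1 + cos (s * U x + c)))) borel X"
    define D' where "D' = distr (density N (\<lambda>y. ennreal (1 + cos (s * V y + c)))) borel Y"
    have "D = D'"
    proof (rule char_eq_imp_eq_finite_measure)
      fix t
      show "char D t = char D' t"
        unfolding D_def D'_def
        using eq[of t s] eq[of t "- s"] eq[of t 0]
        by (subst (1 2) char_weighted_distr(2)) (simp_all add: assms)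
    qed (simp_all add: D_def D'_def char_weighted_distr(1) assms)
    then have "measure D A = measure D' A" by simp
    moreover have "measure D A = (LINT x|M. indicator A (X x) * (1 + cos (s * U x + c)))"
    proof -
      have "measure D A = (LINT x|D. indicator A x)" by (simp add: D_def)
      also have "\<dots> = (LINT x|M. (1 + cos (s * U x + c)) *\<^sub>R indicator A (X x))"
        unfolding D_def
        by (subst integral_distr, simp, simp, subst integral_density)
          (auto intro!: AE_I2 simp: add.commute[of 1] add_nonneg_nonneg intro: order_trans[OF _ add_right_mono[OF cos_ge_minus_one]])
      finally show ?thesis by (simp add: mult.commute)
    qed
    moreover have "measure D' A = (LINT y|N. indicator A (Y y) * (1 + cos (s * V y + c)))"
    proof -
      have "measure D' A = (LINT x|D'. indicator A x)" by (simp add: D'_def)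
      also have "\<dots> = (LINT x|N. (1 + cos (s * V x + c)) *\<^sub>R indicator A (Y x))"
        unfolding D'_def
        by (subst integral_distr, simp, simp, subst integral_density)
          (auto intro!: AE_I2 simp: add.commute[of 1] add_nonneg_nonneg intro: order_trans[OF _ add_right_mono[OF cos_ge_minus_one]])
      finally show ?thesis by (simp add: mult.commute)
    qed
    ultimately show ?thesis by simp
  qed
  have intM: "integrable M (\<lambda>x. indicator A (X x) * f x)"
    if [measurable]: "f \<in> borel_measurable M" and "\<And>x. \<bar>f x\<bar> \<le> 1" for f :: "'a \<Rightarrow> real"
    by (rule M.integrable_const_bound[where B = 1]) (auto simp: that indicator_def)
  have intN: "integrable N (\<lambda>x. indicator A (Y x) * f x)"
    if [measurable]: "f \<in> borel_measurable N" and "\<And>x. \<bar>f x\<bar> \<le> 1" for f :: "'b \<Rightarrow> real"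
    by (rule N.integrable_const_bound[where B = 1]) (auto simp: that indicator_def)
  have cos_eq: "(LINT x|M. indicator A (X x) * cos (U x + c)) = (LINT y|N. indicator A (Y y) * cos (V y + c))" for c
  proof -
    \<comment> \<open>For \<open>s = 0\<close> and \<open>c = 0\<close> the weight is the constant
      2; this isolates the contribution of the summand 1, which is then subtracted.\<close>
    have "(LINT x|M. indicator A (X x) * (1::real)) = (LINT y|N. indicator A (Y y) * (1::real))"
      using weighted[of 0 0] by simp
    moreover have "(LINT x|M. indicator A (X x) * (1 + cos (1 * U x + c)))
        = (LINT x|M. indicator A (X x) * (1::real)) + (LINT x|M. indicator A (X x) * cos (U x + c))"
      unfolding distrib_left mult_1_left
      by (rule Bochner_Integration.integral_add; rule intM; simp)
    moreover have "(LINT y|N. indicator A (Y y) * (1 + cos (1 * V y + c)))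
        = (LINT y|N. indicator A (Y y) * (1::real)) + (LINT y|N. indicator A (Y y) * cos (V y + c))"
      unfolding distrib_left mult_1_left
      by (rule Bochner_Integration.integral_add; rule intN; simp)
    ultimately show ?thesis using weighted[of 1 c] by linarith
  qed
  \<comment> \<open>The phase \<open>- pi / 2\<close> turns the cosine into a sine, so
    \<open>cos_eq\<close> handles real and imaginary part alike.\<close>
  have split: "(CLINT x|density K (\<lambda>x. indicator A (Z x)). iexp (W x))
      = complex_of_real (LINT x|K. indicator A (Z x) * cos (W x + 0))
        + \<i> * complex_of_real (LINT x|K. indicator A (Z x) * cos (W x + (- pi / 2)))"
    if K: "finite_measure K" and [measurable]: "Z \<in> borel_measurable K" "W \<in> borel_measurable K"
    for K :: "'c measure" and Z W :: "'c \<Rightarrow> real"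
  proof -
    interpret K: finite_measure K by fact
    have int: "integrable K (\<lambda>x. indicator A (Z x) * cos (W x + c))" for c
      by (rule K.integrable_const_bound[where B = 1]) (auto simp: indicator_def)
    have "(CLINT x|density K (\<lambda>x. indicator A (Z x)). iexp (W x)) = (CLINT x|density K (\<lambda>x. ennreal (indicator A (Z x))). iexp (W x))"
      by (simp add: ennreal_indicator)
    also have "\<dots> = (CLINT x|K. indicator A (Z x) *\<^sub>R iexp (W x))"
      by (subst integral_density) auto
    finally have dens: "(CLINT x|density K (\<lambda>x. indicator A (Z x)). iexp (W x)) = (CLINT x|K. indicator A (Z x) *\<^sub>R iexp (W x))" .
    have "cos (r + (- pi / 2)) = sin r" for r :: real
      by (simp add: cos_diff)
    then have "(CLINT x|K. indicator A (Z x) *\<^sub>R iexp (W x)) = (CLINT x|K. complex_of_real (indicator A (Z x) * cos (W x + 0))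
        + \<i> * complex_of_real (indicator A (Z x) * cos (W x + (- pi / 2))))"
      by (intro Bochner_Integration.integral_cong refl)
        (auto simp: indicator_def complex_eq_iff Re_exp Im_exp)
    also have "\<dots> = complex_of_real (LINT x|K. indicator A (Z x) * cos (W x + 0))
        + \<i> * complex_of_real (LINT x|K. indicator A (Z x) * cos (W x + (- pi / 2)))"
      using int[of 0] int[of "- pi / 2"]
      by (subst Bochner_Integration.integral_add)
        (simp_all del: of_real_mult add: integrable_of_real)
    finally show ?thesis unfolding dens .
  qed
  show ?thesis
    by (subst (1 2) split) (simp_all only: cos_eq assms)
qed

text \<open>Induction on \<open>J\<close>: one constraint \<open>X i x \<in> A i\<close> is absorbed
  into the measure as an indicator density, and \<open>restricted_char_eq\<close> restores the
  hypothesis on characteristic functions for the remaining indices. This is why the measures vary in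
  the induction and are finite rather than normalised.\<close>

lemma cylinder_measure_eq:
  fixes X :: "'i \<Rightarrow> 'a \<Rightarrow> real" and Y :: "'i \<Rightarrow> 'b \<Rightarrow> real"
  assumes "finite J" "finite_measure M" "finite_measure N"
    and "\<And>i. X i \<in> borel_measurable M" "\<And>i. Y i \<in> borel_measurable N"
    and "\<And>i. A i \<in> sets borel"
    and "\<And>s. (CLINT x|M. iexp (\<Sum>i\<in>J. s i * X i x)) = (CLINT y|N. iexp (\<Sum>i\<in>J. s i * Y i y))"
  shows "emeasure M {x\<in>space M. \<forall>i\<in>J. X i x \<in> A i} = emeasure N {y\<in>space N. \<forall>i\<in>J. Y i y \<in> A i}"
  using assms
proof (induction J arbitrary: M N rule: finite_induct)
  case empty
  interpret M: finite_measure M by fact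
  interpret N: finite_measure N by fact
  show ?case
    using empty(6)[of "\<lambda>_. 0"] by (simp add: M.emeasure_eq_measure N.emeasure_eq_measure)
next
  case (insert i J)
  note [measurable] = insert.prems(3,4,5)
  note char = insert.prems(6)
  define M' where "M' = density M (\<lambda>x. indicator (A i) (X i x))"
  define N' where "N' = density N (\<lambda>x. indicator (A i) (Y i x))"
  have fin: "finite_measure (density K (\<lambda>x. indicator (A i) (Z x)))"
    if "finite_measure K" and [measurable]: "Z \<in> borel_measurable K" for K :: "'c measure" and Z :: "'c \<Rightarrow> real"
  proof -
    interpret K: finite_measure K by fact
    have "emeasure (density K (\<lambda>x. indicator (A i) (Z x))) (space K) \<le> (\<integral>\<^sup>+x. 1 \<partial>K)"
      by (subst emeasure_density, simp, simp, rule nn_integral_mono) (auto simp: indicator_def)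
    then show ?thesis
      by (intro finite_measureI) (auto simp: K.emeasure_eq_measure top_unique)
  qed
  have "emeasure M' {x\<in>space M'. \<forall>i\<in>J. X i x \<in> A i} = emeasure N' {y\<in>space N'. \<forall>i\<in>J. Y i y \<in> A i}"
  proof (rule insert.IH)
    fix s
    have "(CLINT x|M. iexp (t * X i x + r * (\<Sum>k\<in>J. s k * X k x)))
        = (CLINT y|N. iexp (t * Y i y + r * (\<Sum>k\<in>J. s k * Y k y)))" for t r
    proof -
      \<comment> \<open>With coefficient \<open>t\<close> at \<open>i\<close> and
        \<open>r * s k\<close> elsewhere, \<open>char\<close> becomes the joint characteristic
        function of \<open>X i\<close> and the combination over \<open>J\<close>.\<close>
      have *: "(\<Sum>k\<in>insert i J. (if k = i then t else r * s k) * f k) = t * f i + r * (\<Sum>k\<in>J. s k * f k)" for f :: "'i \<Rightarrow> real"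
        using insert.hyps by (auto simp: sum_distrib_left mult.assoc intro!: sum.cong)
      show ?thesis
        using char[of "\<lambda>k. if k = i then t else r * s k"] unfolding * .
    qed
    then show "(CLINT x|M'. iexp (\<Sum>k\<in>J. s k * X k x)) = (CLINT y|N'. iexp (\<Sum>k\<in>J. s k * Y k y))"
      unfolding M'_def N'_def
      by (intro restricted_char_eq insert.prems(1,2)) (simp_all del: of_real_sum of_real_mult of_real_add)
  qed (auto simp: M'_def N'_def intro!: fin insert.prems)
  moreover have "emeasure M' {x\<in>space M'. \<forall>i\<in>J. X i x \<in> A i} = emeasure M {x\<in>space M. \<forall>i\<in>insert i J. X i x \<in> A i}"
    unfolding M'_def using \<open>finite J\<close>
    by (subst emeasure_density) (auto simp: nn_integral_indicator[symmetric] indicator_def intro!: nn_integral_cong simp del: nn_integral_indicator)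
  moreover have "emeasure N' {x\<in>space N'. \<forall>i\<in>J. Y i x \<in> A i} = emeasure N {x\<in>space N. \<forall>i\<in>insert i J. Y i x \<in> A i}"
    unfolding N'_def using \<open>finite J\<close>
    by (subst emeasure_density) (auto simp: nn_integral_indicator[symmetric] indicator_def intro!: nn_integral_cong simp del: nn_integral_indicator)
  ultimately show ?case by simp
qed

text \<open>Cylinders determine a finite measure on the product. The index type is arbitrary, so
  that one sequence and a pair of sequences are treated alike.\<close>

lemma distr_PiM_eqI_char:
  fixes X :: "'i \<Rightarrow> 'a \<Rightarrow> real" and Y :: "'i \<Rightarrow> 'b \<Rightarrow> real"
  assumes M: "finite_measure M" and N: "finite_measure N"
    and [measurable]: "\<And>i. X i \<in> borel_measurable M" "\<And>i. Y i \<in> borel_measurable N"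
    and char: "\<And>J s. finite J \<Longrightarrow>
      (CLINT x|M. iexp (\<Sum>i\<in>J. s i * X i x)) = (CLINT y|N. iexp (\<Sum>i\<in>J. s i * Y i y))"
  shows "distr M (PiM UNIV (\<lambda>_. borel)) (\<lambda>x i. X i x) = distr N (PiM UNIV (\<lambda>_. borel)) (\<lambda>y i. Y i y)"
proof (rule measure_eqI_PiM_infinite)
  have [measurable]: "(\<lambda>x i. X i x) \<in> measurable M (PiM UNIV (\<lambda>_. borel))"
    "(\<lambda>x i. Y i x) \<in> measurable N (PiM UNIV (\<lambda>_. borel))"
    by (auto intro!: measurable_PiM_single')
  interpret M: finite_measure M by fact
  show "finite_measure (distr M (PiM UNIV (\<lambda>_. borel)) (\<lambda>x i. X i x))"
    by (rule M.finite_measure_distr) measurable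
  fix A :: "'i \<Rightarrow> real set" and J :: "'i set"
  assume J: "finite J" and A: "\<And>i. i \<in> J \<Longrightarrow> A i \<in> sets borel"
  \<comment> \<open>\<open>cylinder_measure_eq\<close> wants measurable sets at every index; the
    trivial constraint outside \<open>J\<close> supplies them.\<close>
  define B where "B i = (if i \<in> J then A i else UNIV)" for i
  have emb: "prod_emb UNIV (\<lambda>_. borel) J (Pi\<^sub>E J A) = {f. \<forall>i\<in>J. f i \<in> B i}"
    by (auto simp: prod_emb_def B_def PiE_def Pi_def)
  have [measurable]: "{f. \<forall>i\<in>J. f i \<in> B i} \<in> sets (PiM UNIV (\<lambda>_. borel :: real measure))"
    unfolding emb[symmetric] using J A by (intro sets_PiM_I) auto
  have "emeasure M {x\<in>space M. \<forall>i\<in>J. X i x \<in> B i} = emeasure N {y\<in>space N. \<forall>i\<in>J. Y i y \<in> B i}"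
    by (rule cylinder_measure_eq[OF J M N]) (auto simp: B_def A char[OF J] simp del: of_real_sum of_real_mult)
  then show "emeasure (distr M (PiM UNIV (\<lambda>_. borel)) (\<lambda>x i. X i x)) (prod_emb UNIV (\<lambda>_. borel) J (Pi\<^sub>E J A))
      = emeasure (distr N (PiM UNIV (\<lambda>_. borel)) (\<lambda>y i. Y i y)) (prod_emb UNIV (\<lambda>_. borel) J (Pi\<^sub>E J A))"
    unfolding emb by (simp add: emeasure_distr vimage_def Int_def conj_commute)
qed simp_all

section \<open>Total boundedness, weights and exponential integrals\<close>

lemma ennreal_add_power2_le: "((x::ennreal) + y)\<^sup>2 \<le> 2 * x\<^sup>2 + 2 * y\<^sup>2"
proof (cases "x = \<top> \<or> y = \<top>")
  case True
  then show ?thesis by (auto simp: ennreal_mult_eq_top_iff power2_eq_square)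
next
  case False
  then obtain a b where ab: "x = ennreal a" "0 \<le> a" "y = ennreal b" "0 \<le> b"
    by (metis ennreal_cases)
  have "(a + b)\<^sup>2 \<le> 2 * a\<^sup>2 + 2 * b\<^sup>2"
    using sum_squares_bound[of a b] by (simp add: power2_sum)
  then have "ennreal ((a + b)\<^sup>2) \<le> ennreal (2 * a\<^sup>2 + 2 * b\<^sup>2)"
    by (rule ennreal_leI)
  then show ?thesis
    using ab by (simp add: ennreal_power[symmetric] ennreal_mult)
qed

section \<open>Compactness criteria\<close>

text \<open>Passing to half the radius leaves room for the closure: finitely many closed balls of
  radius \<open>\<epsilon> / 2\<close> have a closed union, which lies in the open balls of radius
  \<open>\<epsilon>\<close>.\<close>

lemma compact_closure_if_totally_bounded:
  fixes A :: "'a::{metric_space, complete_space} set"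
  assumes "\<And>\<epsilon>. 0 < \<epsilon> \<Longrightarrow> \<exists>K. finite K \<and> A \<subseteq> (\<Union>x\<in>K. ball x \<epsilon>)"
  shows "compact (closure A)"
proof -
  have "\<exists>k. finite k \<and> closure A \<subseteq> (\<Union>x\<in>k. ball x \<epsilon>)" if "0 < \<epsilon>" for \<epsilon>
  proof -
  from that obtain K where K: "finite K" "A \<subseteq> (\<Union>x\<in>K. ball x (\<epsilon> / 2))"
    using assms[of "\<epsilon> / 2"] by auto
  have "closed (\<Union>x\<in>K. cball x (\<epsilon> / 2))"
    using K(1) by auto
  moreover have "A \<subseteq> (\<Union>x\<in>K. cball x (\<epsilon> / 2))"
    using K(2) by (rule order_trans) (intro UN_mono ball_subset_cball order_refl)
  ultimately have "closure A \<subseteq> (\<Union>x\<in>K. cball x (\<epsilon> / 2))"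
    by (rule closure_minimal[rotated])
  also have "\<dots> \<subseteq> (\<Union>x\<in>K. ball x \<epsilon>)"
    using \<open>0 < \<epsilon>\<close> by (intro UN_mono order_refl) auto
  finally show ?thesis
    using K(1) by blast
  qed
  then show ?thesis
    by (simp add: compact_eq_totally_bounded complete_eq_closed)
qed

text \<open>The box is a Minkowski sum of compact segments, added one at a time; the vectors may be
  linearly dependent.\<close>

lemma compact_box_sum:
  fixes v :: "nat \<Rightarrow> 'a::real_normed_vector"
  shows "compact {\<Sum>k<m. c k *\<^sub>R v k | c. \<forall>k<m. \<bar>c k\<bar> \<le> r k}"
proof (induction m)
  case (Suc m)
  have "{\<Sum>k<Suc m. c k *\<^sub>R v k | c. \<forall>k<Suc m. \<bar>c k\<bar> \<le> r k}
      = {x + y | x y. x \<in> {\<Sum>k<m. c k *\<^sub>R v k | c. \<forall>k<m. \<bar>c k\<bar> \<le> r k} \<and> y \<in> (\<lambda>t. t *\<^sub>R v m) ` {- r m..r m}}"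
    (is "?A = ?B")
  proof
    show "?A \<subseteq> ?B"
      by (fastforce simp: less_Suc_eq abs_le_iff)
    show "?B \<subseteq> ?A"
    proof clarify
      fix c t assume *: "\<forall>k<m. \<bar>c k\<bar> \<le> r k" "t \<in> {- r m..r m}"
      then show "\<exists>c'. (\<Sum>k<m. c k *\<^sub>R v k) + t *\<^sub>R v m = (\<Sum>k<Suc m. c' k *\<^sub>R v k) \<and> (\<forall>k<Suc m. \<bar>c' k\<bar> \<le> r k)"
        by (intro exI[of _ "c(m := t)"]) (auto simp: less_Suc_eq)
    qed
  qed
  moreover have "compact ((\<lambda>t. t *\<^sub>R v m) ` {- r m..r m})"
    by (intro compact_continuous_image continuous_intros) auto
  ultimately show ?case by (simp only: compact_sums[OF Suc])
qed simp

section \<open>Dyadic weights\<close>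

text \<open>Coordinates are counted from 0 here, so index \<open>n\<close> carries the weight that
  the context gives to the basis vector with number \<open>Suc n\<close>.\<close>

definition dyadic_weight :: "nat \<Rightarrow> real" where
  "dyadic_weight n = 2 powr (- real (Suc n) / 2)"

lemma dyadic_weight_pos: "0 < dyadic_weight n"
  by (simp add: dyadic_weight_def)

lemma dyadic_weight_eq: "dyadic_weight n = (2 powr (- 1 / 2)) ^ Suc n"
  by (simp add: dyadic_weight_def powr_realpow[symmetric] powr_powr powr_add[symmetric] field_simps)

lemma summable_dyadic_weight: "summable dyadic_weight"
proof -
  have "(2::real) powr (- 1 / 2) < 2 powr 0" by (rule powr_less_mono) auto
  then have "summable (\<lambda>n. (2 powr (- 1 / 2) :: real) ^ n)"
    by (intro summable_geometric) simp
  then show ?thesis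
    unfolding dyadic_weight_eq[abs_def] by (subst summable_Suc_iff)
qed

lemma suminf_dyadic_weight_finite: "(\<Sum>n. ennreal (dyadic_weight n)) < \<top>"
  using summable_dyadic_weight dyadic_weight_pos
  by (subst suminf_ennreal2) (auto intro: less_imp_le)

text \<open>Half of each weight, as a square root, goes to either factor, and the sums are read as
  integrals over the counting measure. This reduces the weighted sum of absolute values to second
  moments of single coordinates.\<close>

lemma weighted_cauchy_schwarz:
  "(\<Sum>n. ennreal (dyadic_weight n * \<bar>\<eta> n\<bar>))\<^sup>2
    \<le> (\<Sum>n. ennreal (dyadic_weight n)) * (\<Sum>n. ennreal (dyadic_weight n * (\<eta> n)\<^sup>2))"
proof -
  let ?c = "\<lambda>n. sqrt (dyadic_weight n)"
  have c: "?c n * ?c n = dyadic_weight n" "0 \<le> ?c n" for n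
    using dyadic_weight_pos[of n] by simp_all
  have "(\<integral>\<^sup>+n. ennreal (?c n) * ennreal (?c n * \<bar>\<eta> n\<bar>) \<partial>count_space UNIV)\<^sup>2
      \<le> (\<integral>\<^sup>+n. (ennreal (?c n))\<^sup>2 \<partial>count_space UNIV) * (\<integral>\<^sup>+n. (ennreal (?c n * \<bar>\<eta> n\<bar>))\<^sup>2 \<partial>count_space UNIV)"
    by (rule Cauchy_Schwarz_nn_integral) auto
  moreover have "ennreal (?c n) * ennreal (?c n * \<bar>\<eta> n\<bar>) = ennreal (dyadic_weight n * \<bar>\<eta> n\<bar>)"
    "(ennreal (?c n))\<^sup>2 = ennreal (dyadic_weight n)"
    "(ennreal (?c n * \<bar>\<eta> n\<bar>))\<^sup>2 = ennreal (dyadic_weight n * (\<eta> n)\<^sup>2)" for n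
    using c[of n] dyadic_weight_pos[of n]
    by (simp_all add: ennreal_mult'[symmetric] ennreal_power power_mult_distrib mult.assoc[symmetric] less_imp_le)
  ultimately show ?thesis
    by (simp add: nn_integral_count_space_nat)
qed

lemma ennreal_sqrt_power2: "(ennreal_sqrt a)\<^sup>2 = a"
  by (cases a) (auto simp: ennreal_sqrt_def ennreal_power power2_eq_square ennreal_mult'[symmetric])

section \<open>Exponential weights of the resolvent\<close>

lemma SUP_one_minus_exp:
  assumes "0 < r"
  shows "(SUP n. ennreal (1 - exp (- (real n * r)))) = 1"
proof (rule LIMSEQ_unique)
  have "incseq (\<lambda>n. ennreal (1 - exp (- (real n * r))))"
    using assms by (intro incseq_SucI ennreal_leI) (simp add: algebra_simps)
  then show "(\<lambda>n. ennreal (1 - exp (- (real n * r)))) \<longlonglongrightarrow> (SUP n. ennreal (1 - exp (- (real n * r))))"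
    by (rule LIMSEQ_SUP)
  have "(\<lambda>n. exp (- r) ^ n) \<longlonglongrightarrow> 0"
    using assms by (intro LIMSEQ_power_zero) simp
  then have "(\<lambda>n. ennreal (1 - exp (- r) ^ n)) \<longlonglongrightarrow> ennreal (1 - 0)"
    by (intro tendsto_ennrealI tendsto_diff tendsto_const)
  then show "(\<lambda>n. ennreal (1 - exp (- (real n * r)))) \<longlonglongrightarrow> 1"
    by (simp add: exp_of_nat_mult[symmetric])
qed

lemma nn_integral_exp_truncated:
  assumes "0 < \<alpha>" "0 \<le> r"
  shows "ennreal \<alpha> * (\<integral>\<^sup>+s. ennreal (exp (- \<alpha> * s)) * indicator {0..r} s \<partial>lborel) = ennreal (1 - exp (- \<alpha> * r))"
proof -
  have "(\<integral>\<^sup>+s. ennreal (exp (- \<alpha> * s)) * indicator {0..r} s \<partial>lborel)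
      = ennreal ((- exp (- \<alpha> * r) / \<alpha>) - (- exp (- \<alpha> * 0) / \<alpha>))"
    using assms by (intro nn_integral_FTC_Icc) (auto intro!: derivative_eq_intros simp: field_simps)
  also have "ennreal \<alpha> * \<dots> = ennreal (1 - exp (- \<alpha> * r))"
    using assms by (subst ennreal_mult'[symmetric]) (auto simp: field_simps)
  finally show ?thesis .
qed

section \<open>Laws of the coordinates\<close>

text \<open>The basis is reindexed from 0, and \<open>N n\<close> counts the coordinates that enter
  the \<open>n\<close>-th projection; \<open>N_0\<close> thus encodes that the projection with index
  0 vanishes.\<close>

locale wiener_basis = abstract_wiener_space \<mu> j
  for \<mu> :: "'e::banach measure" and j :: "'h::{real_inner, polish_space} \<Rightarrow> 'e" +
  fixes e :: "nat \<Rightarrow> 'h" and L :: "nat \<Rightarrow> 'e \<Rightarrow> real" and N :: "nat \<Rightarrow> nat"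
  assumes orthonormal: "e i \<bullet> e k = (if i = k then 1 else 0)"
    and dual: "riesz_rep j (L k) (e k)"
    and separates: "(\<And>k. L k z = L k w) \<Longrightarrow> z = w"
    and N_0: "N 0 = 0"
    and N_mono: "strict_mono N"
    and tail: "1 \<le> n \<Longrightarrow>
      measure \<mu> {z. norm (z - j (\<Sum>k<N n. L k z *\<^sub>R e k)) > (1 / 2) ^ n} \<le> (1 / 2) ^ n"
begin

declare sets_mu [measurable_cong]

lemma space_mu [simp]: "space \<mu> = UNIV"
  using sets_eq_imp_space_eq[OF sets_mu] by simp

sublocale pair: pair_prob_space \<mu> \<mu> ..

lemma bounded_linear_L: "bounded_linear (L k)"
  using dual by (simp add: riesz_rep_def)

lemma L_add: "L k (z + w) = L k z + L k w"
  and L_diff: "L k (z - w) = L k z - L k w"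
  and L_scale: "L k (c *\<^sub>R z) = c * L k z"
  using bounded_linear_L[of k] by (simp_all add: linear_simps)

lemma L_e: "L k (j (e i)) = (if k = i then 1 else 0)"
  using dual[of k] orthonormal by (simp add: riesz_rep_def)

lemma continuous_L: "continuous_on A (L k)"
  by (rule linear_continuous_on[OF bounded_linear_L])

lemma measurable_L [measurable]: "L k \<in> borel_measurable borel"
  by (rule borel_measurable_continuous_onI[OF continuous_L])

text \<open>Divided by \<open>r\<close>, the combination is represented by a unit vector of
  \<open>H\<close>, hence is standard normal, and the claim is its characteristic function at
  \<open>r\<close>. If all coefficients vanish this division is impossible, but then the integrand
  is constant.\<close>

lemma char_L:
  assumes "finite J"
  shows "(CLINT z|\<mu>. iexp (\<Sum>k\<in>J. s k * L k z)) = complex_of_real (exp (- (\<Sum>k\<in>J. (s k)\<^sup>2) / 2))"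
proof (cases "\<forall>k\<in>J. s k = 0")
  case True
  then have *: "(\<Sum>k\<in>J. s k * f k) = 0" "(\<Sum>k\<in>J. (s k)\<^sup>2) = 0" for f
    by (auto intro!: sum.neutral)
  show ?thesis unfolding * using prob_space by simp
next
  case False
  define r where "r = sqrt (\<Sum>k\<in>J. (s k)\<^sup>2)"
  have pos: "0 < (\<Sum>k\<in>J. (s k)\<^sup>2)"
    using False \<open>finite J\<close> by (auto intro!: sum_pos2)
  then have r: "r > 0" "r\<^sup>2 = (\<Sum>k\<in>J. (s k)\<^sup>2)"
    by (simp_all add: r_def)
  define l where "l z = (\<Sum>k\<in>J. (s k / r) * L k z)" for z
  have "bounded_linear l"
    unfolding l_def by (intro bounded_linear_sum bounded_linear_const_mult bounded_linear_L)
  then obtain h where h: "riesz_rep j l h" "distr \<mu> borel l = normal_law 0 (norm h)"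
    using gaussian by blast
  have "h = (\<Sum>k\<in>J. (s k / r) *\<^sub>R e k)"
  proof (rule vector_eq_ldot[THEN iffD1, OF allI])
    fix k
    show "k \<bullet> h = k \<bullet> (\<Sum>k\<in>J. (s k / r) *\<^sub>R e k)"
      using h(1) dual by (simp add: riesz_rep_def l_def inner_sum_right inner_commute)
  qed
  then have "h \<bullet> h = (\<Sum>k\<in>J. (s k / r)\<^sup>2)"
    using \<open>finite J\<close>
    by (simp add: inner_sum_right inner_sum_left orthonormal if_distrib[of "\<lambda>x. _ * x"] power2_eq_square
        sum.delta cong: if_cong)
  also have "\<dots> = r\<^sup>2 / r\<^sup>2"
    by (simp only: r(2) power_divide sum_divide_distrib)
  finally have "norm h = 1"
    using r(1) by (simp add: norm_eq_sqrt_inner)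
  then have law: "distr \<mu> borel l = std_normal_distribution"
    using h(2) by (simp add: normal_law_def)
  have [measurable]: "l \<in> borel_measurable borel" unfolding l_def by measurable
  have "(\<Sum>k\<in>J. s k * L k z) = r * l z" for z
    using r(1) by (simp add: l_def sum_distrib_left)
  then have "(CLINT z|\<mu>. iexp (\<Sum>k\<in>J. s k * L k z)) = char (distr \<mu> borel l) r"
    unfolding char_def by (subst integral_distr) auto
  also have "\<dots> = complex_of_real (exp (- (\<Sum>k\<in>J. (s k)\<^sup>2) / 2))"
    unfolding law char_std_normal_distribution r(2) ..
  finally show ?thesis .
qed

lemma char_L_pair:
  assumes "finite J"
  shows "(CLINT p|\<mu> \<Otimes>\<^sub>M \<mu>. iexp (\<Sum>k\<in>J. a k * L k (fst p) + b k * L k (snd p)))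
    = complex_of_real (exp (- (\<Sum>k\<in>J. (a k)\<^sup>2 + (b k)\<^sup>2) / 2))"
proof -
  let ?f = "\<lambda>z. \<Sum>k\<in>J. a k * L k z" and ?g = "\<lambda>z. \<Sum>k\<in>J. b k * L k z"
  have "(CLINT p|\<mu> \<Otimes>\<^sub>M \<mu>. iexp (\<Sum>k\<in>J. a k * L k (fst p) + b k * L k (snd p)))
      = (CLINT p|\<mu> \<Otimes>\<^sub>M \<mu>. case p of (z, w) \<Rightarrow> iexp (?f z) * iexp (?g w))"
    by (intro Bochner_Integration.integral_cong refl)
      (auto simp: sum.distrib exp_add[symmetric] algebra_simps)
  also have "\<dots> = (CLINT z|\<mu>. CLINT w|\<mu>. iexp (?f z) * iexp (?g w))"
    by (subst pair.integral_fst'[symmetric])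
      (auto intro!: pair.P.integrable_const_bound[where B = 1] simp: split_beta norm_mult
        simp del: of_real_sum of_real_mult)
  also have "\<dots> = (CLINT z|\<mu>. iexp (?f z)) * (CLINT w|\<mu>. iexp (?g w))"
    by (simp del: of_real_sum of_real_mult)
  also have "\<dots> = complex_of_real (exp (- (\<Sum>k\<in>J. (a k)\<^sup>2 + (b k)\<^sup>2) / 2))"
    unfolding char_L[OF assms]
    by (simp add: sum.distrib exp_add[symmetric] add_divide_distrib flip: of_real_mult)
  finally show ?thesis .
qed

abbreviation S :: "(nat \<Rightarrow> real) measure" where
  "S \<equiv> PiM UNIV (\<lambda>_. borel)"

text \<open>Sums of independent centred Gaussians add their variances. With
  \<open>a = sqrt s\<close> and \<open>b = sqrt t\<close> this is the semigroup property.\<close>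

lemma convolution_law:
  assumes "c\<^sup>2 = a\<^sup>2 + b\<^sup>2"
  shows "distr (\<mu> \<Otimes>\<^sub>M \<mu>) S (\<lambda>p k. a * L k (fst p) + b * L k (snd p)) = distr \<mu> S (\<lambda>w k. c * L k w)"
proof (rule distr_PiM_eqI_char)
  fix J :: "nat set" and s :: "nat \<Rightarrow> real"
  assume J: "finite J"
  have "(CLINT p|\<mu> \<Otimes>\<^sub>M \<mu>. iexp (\<Sum>k\<in>J. s k * (a * L k (fst p) + b * L k (snd p))))
      = complex_of_real (exp (- (\<Sum>k\<in>J. (s k * a)\<^sup>2 + (s k * b)\<^sup>2) / 2))"
    unfolding char_L_pair[OF J, symmetric] by (simp only: distrib_left mult.assoc)
  also have "(\<Sum>k\<in>J. (s k * a)\<^sup>2 + (s k * b)\<^sup>2) = (\<Sum>k\<in>J. (s k * c)\<^sup>2)"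
    by (simp add: power_mult_distrib assms distrib_left)
  also have "complex_of_real (exp (- (\<Sum>k\<in>J. (s k * c)\<^sup>2) / 2)) = (CLINT z|\<mu>. iexp (\<Sum>k\<in>J. s k * (c * L k z)))"
    unfolding char_L[OF J, symmetric] by (simp only: mult.assoc)
  finally show "(CLINT p|\<mu> \<Otimes>\<^sub>M \<mu>. iexp (\<Sum>k\<in>J. s k * (a * L k (fst p) + b * L k (snd p))))
      = (CLINT z|\<mu>. iexp (\<Sum>k\<in>J. s k * (c * L k z)))" .
qed (auto intro: finite_measure_axioms pair.P.finite_measure_axioms)

text \<open>A rotation by 45 degrees preserves the quadratic form in the exponent of the
  characteristic function. The Boolean index selects one of the two sequences, so that their joint
  law is recorded.\<close>

lemma rotation_law:
  "distr (\<mu> \<Otimes>\<^sub>M \<mu>) (PiM UNIV (\<lambda>_. borel))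
      (\<lambda>p i. if fst i then (L (snd i) (fst p) - L (snd i) (snd p)) / sqrt 2
             else (L (snd i) (fst p) + L (snd i) (snd p)) / sqrt 2)
    = distr (\<mu> \<Otimes>\<^sub>M \<mu>) (PiM UNIV (\<lambda>_. borel))
      (\<lambda>p i. if fst i then L (snd i) (fst p) else L (snd i) (snd p))"
    (is "distr _ _ (\<lambda>p i. ?X i p) = distr _ _ (\<lambda>p i. ?Y i p)")
proof (rule distr_PiM_eqI_char)
  fix J :: "(bool \<times> nat) set" and s :: "bool \<times> nat \<Rightarrow> real"
  assume J: "finite J"
  define K where "K = snd ` J"
  have K: "finite K" using J by (simp add: K_def)
  \<comment> \<open>Extending the coefficients by zero to the rectangle
    \<open>UNIV \<times> K\<close> lets both sequences run over the same finite set, as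
    \<open>char_L_pair\<close> requires.\<close>
  define t where "t b k = (if (b, k) \<in> J then s (b, k) else 0)" for b k
  have *: "(\<Sum>i\<in>J. s i * f i) = (\<Sum>k\<in>K. t True k * f (True, k) + t False k * f (False, k))" for f
  proof -
    have "(\<Sum>i\<in>J. s i * f i) = (\<Sum>i\<in>UNIV \<times> K. t (fst i) (snd i) * f i)"
      using K by (intro sum.mono_neutral_cong_left) (force simp: t_def K_def)+
    also have "\<dots> = (\<Sum>b\<in>UNIV. \<Sum>k\<in>K. t b k * f (b, k))"
      by (simp add: sum.cartesian_product split_beta)
    finally show ?thesis by (simp add: UNIV_bool sum.distrib add.commute)
  qed
  have X: "(\<Sum>i\<in>J. s i * ?X i p) = (\<Sum>k\<in>K. ((t True k + t False k) / sqrt 2) * L k (fst p)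
      + ((t False k - t True k) / sqrt 2) * L k (snd p))" for p
    unfolding * by (intro sum.cong refl) (simp add: field_simps)
  have Y: "(\<Sum>i\<in>J. s i * ?Y i p) = (\<Sum>k\<in>K. t True k * L k (fst p) + t False k * L k (snd p))" for p
    unfolding * by simp
  have "((t True k + t False k) / sqrt 2)\<^sup>2 + ((t False k - t True k) / sqrt 2)\<^sup>2 = (t True k)\<^sup>2 + (t False k)\<^sup>2" for k
    by (simp add: power_divide power2_eq_square field_simps)
  then show "(CLINT p|\<mu> \<Otimes>\<^sub>M \<mu>. iexp (\<Sum>i\<in>J. s i * ?X i p)) = (CLINT p|\<mu> \<Otimes>\<^sub>M \<mu>. iexp (\<Sum>i\<in>J. s i * ?Y i p))"
    unfolding X Y char_L_pair[OF K] by simp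
qed (auto intro: pair.P.finite_measure_axioms)

subsection \<open>Integrability of seminorms\<close>

definition Lam :: "'e \<Rightarrow> nat \<Rightarrow> real" where
  "Lam z k = L k z"

lemma measurable_Lam [measurable]: "Lam \<in> measurable borel S"
  unfolding Lam_def by (rule measurable_PiM_single') auto

text \<open>If \<open>p ((x - y) / \<surd>2) \<le> u\<close> and \<open>p ((x + y) / \<surd>2) > 3 u\<close>, then \<open>p x > u\<close> and \<open>p y > u\<close>;
  compare the probabilities of both events under \<open>\<mu> \<Otimes> \<mu>\<close>, which is invariant under this rotation.\<close>

lemma fernique_step:
  fixes p :: "(nat \<Rightarrow> real) \<Rightarrow> real"
  assumes [measurable]: "p \<in> borel_measurable S"
    and tri: "\<And>\<eta> \<zeta>. p (\<lambda>k. \<eta> k + \<zeta> k) \<le> p \<eta> + p \<zeta>"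
    and scale: "\<And>c \<eta>. p (\<lambda>k. c * \<eta> k) = \<bar>c\<bar> * p \<eta>"
    and u: "0 < u"
  shows "prob {z. p (Lam z) > 3 * u} * (1 - prob {z. p (Lam z) > u}) \<le> (prob {z. p (Lam z) > u})\<^sup>2"
proof -
  let ?PP = "\<mu> \<Otimes>\<^sub>M \<mu>"
  have prod: "measure ?PP (A \<times> B) = prob A * prob B" if "A \<in> sets borel" "B \<in> sets borel" for A B
    using that by (simp add: measure_def emeasure_pair_measure_Times enn2real_mult)
  have [measurable]: "{z. p (Lam z) > c} \<in> sets borel" "{z. p (Lam z) \<le> c} \<in> sets borel" for c
    by measurable
  \<comment> \<open>One event, read twice: for the independent pair its probability is a product,
    for the rotated pair it constrains the difference and the sum.\<close>
  define R where "R = {\<xi>\<in>space (PiM UNIV (\<lambda>_. borel)). p (\<lambda>k. \<xi> (True, k)) \<le> u \<and> 3 * u < p (\<lambda>k. \<xi> (False, k))}"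
  have [measurable]: "(\<lambda>\<xi> k. \<xi> (b, k)) \<in> measurable (PiM UNIV (\<lambda>_. borel :: real measure)) S" for b :: bool
    by (rule measurable_PiM_single') auto
  have R [measurable]: "R \<in> sets (PiM UNIV (\<lambda>_. borel))"
    unfolding R_def by measurable
  have [measurable]: "(\<lambda>p i. if fst i then (L (snd i) (fst p) - L (snd i) (snd p)) / sqrt 2
      else (L (snd i) (fst p) + L (snd i) (snd p)) / sqrt 2) \<in> measurable ?PP (PiM UNIV (\<lambda>_. borel))"
    "(\<lambda>p i. if fst i then L (snd i) (fst p) else L (snd i) (snd p)) \<in> measurable ?PP (PiM UNIV (\<lambda>_. borel))"
    by (rule measurable_PiM_single'; simp)+
  have "prob {z. p (Lam z) > 3 * u} * (1 - prob {z. p (Lam z) > u})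
      = prob {z. p (Lam z) \<le> u} * prob {z. p (Lam z) > 3 * u}"
  proof -
    have "{z. p (Lam z) \<le> u} = space \<mu> - {z. p (Lam z) > u}" by auto
    then have "prob {z. p (Lam z) \<le> u} = 1 - prob {z. p (Lam z) > u}"
      using prob_compl[of "{z. p (Lam z) > u}"] by (simp add: sets_mu)
    then show ?thesis by simp
  qed
  also have "\<dots> = measure ?PP ({z. p (Lam z) \<le> u} \<times> {z. p (Lam z) > 3 * u})"
    by (simp add: prod)
  also have "\<dots> = measure (distr ?PP (PiM UNIV (\<lambda>_. borel))
      (\<lambda>p i. if fst i then L (snd i) (fst p) else L (snd i) (snd p))) R"
    by (subst measure_distr, simp, rule R)
      (auto simp: R_def Lam_def[abs_def] space_PiM space_pair_measure intro!: arg_cong[where f = "measure _"])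
  also have "\<dots> = measure ?PP {x. p (\<lambda>k. (L k (fst x) - L k (snd x)) / sqrt 2) \<le> u
      \<and> 3 * u < p (\<lambda>k. (L k (fst x) + L k (snd x)) / sqrt 2)}"
    unfolding rotation_law[symmetric]
    by (subst measure_distr, simp, rule R)
      (auto simp: R_def space_PiM space_pair_measure intro!: arg_cong[where f = "measure _"])
  also have "\<dots> \<le> measure ?PP ({z. p (Lam z) > u} \<times> {z. p (Lam z) > u})"
  proof (rule pair.P.finite_measure_mono, safe)
    fix x y
    assume *: "p (\<lambda>k. (L k (fst (x, y)) - L k (snd (x, y))) / sqrt 2) \<le> u"
      "3 * u < p (\<lambda>k. (L k (fst (x, y)) + L k (snd (x, y))) / sqrt 2)"
    define a where "a = (\<lambda>k. Lam x k - Lam y k)"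
    define b where "b = (\<lambda>k. Lam x k + Lam y k)"
    have "p (\<lambda>k. a k / sqrt 2) = p a / sqrt 2" "p (\<lambda>k. b k / sqrt 2) = p b / sqrt 2"
      using scale[of "1 / sqrt 2" a] scale[of "1 / sqrt 2" b] by simp_all
    moreover have "p (\<lambda>k. a k / sqrt 2) \<le> u" "3 * u < p (\<lambda>k. b k / sqrt 2)"
      using * by (simp_all add: a_def b_def Lam_def)
    ultimately have "p a \<le> sqrt 2 * u" "sqrt 2 * (3 * u) < p b"
      by (simp_all add: pos_divide_le_eq pos_less_divide_eq mult.commute)
    \<comment> \<open>The sum \<open>b\<close> is both \<open>2 x - a\<close> and
      \<open>2 y + a\<close>. Hence twice the seminorm of either point exceeds
      \<open>sqrt 2 * (3 * u) - sqrt 2 * u\<close>, and the seminorm itself exceeds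
      \<open>sqrt 2 * u\<close>.\<close>
    moreover have "sqrt 2 * u \<ge> u" using u by simp
    moreover have "p b \<le> 2 * p (Lam x) + p a"
    proof -
      have "p b = p (\<lambda>k. 2 * Lam x k + - 1 * a k)" by (rule arg_cong[of _ _ p]) (simp add: a_def b_def)
      also have "\<dots> \<le> p (\<lambda>k. 2 * Lam x k) + p (\<lambda>k. - 1 * a k)" by (rule tri)
      finally show ?thesis unfolding scale by simp
    qed
    moreover have "p b \<le> 2 * p (Lam y) + p a"
    proof -
      have "p b = p (\<lambda>k. 2 * Lam y k + a k)" by (rule arg_cong[of _ _ p]) (simp add: a_def b_def add.commute)
      also have "\<dots> \<le> p (\<lambda>k. 2 * Lam y k) + p a" by (rule tri)
      finally show ?thesis unfolding scale by simp
    qed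
    ultimately show "u < p (Lam x)" "u < p (Lam y)" by simp_all
  qed (simp add: sets_pair_measure_cong[OF sets_mu sets_mu])
  also have "\<dots> = (prob {z. p (Lam z) > u})\<^sup>2"
    by (simp add: prod power2_eq_square)
  finally show ?thesis .
qed

text \<open>Iterating \<open>fernique_step\<close> along the radii \<open>3 ^ k * u\<close> makes
  the tails decay like \<open>(1 / 12) ^ k\<close>, whereas the squared radii grow only like
  \<open>9 ^ k\<close>. Summing over shells therefore gives a geometric series with ratio
  3/4.\<close>

lemma fernique_second_moment:
  fixes p :: "(nat \<Rightarrow> real) \<Rightarrow> real"
  assumes meas [measurable]: "p \<in> borel_measurable S"
    and tri: "\<And>\<eta> \<zeta>. p (\<lambda>k. \<eta> k + \<zeta> k) \<le> p \<eta> + p \<zeta>"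
    and scale: "\<And>c \<eta>. p (\<lambda>k. c * \<eta> k) = \<bar>c\<bar> * p \<eta>"
    and u: "0 < u" and small: "prob {z. p (Lam z) > u} \<le> 1 / 16"
  shows "(\<integral>\<^sup>+z. ennreal ((p (Lam z))\<^sup>2) \<partial>\<mu>) \<le> ennreal (4 * u\<^sup>2)"
proof -
  define P where "P v = prob {z. p (Lam z) > v}" for v
  have nonneg: "0 \<le> p \<eta>" for \<eta>
  proof -
    have "p (\<lambda>k. \<eta> k + - 1 * \<eta> k) \<le> p \<eta> + p (\<lambda>k. - 1 * \<eta> k)" by (rule tri)
    moreover have "p (\<lambda>k. \<eta> k + - 1 * \<eta> k) = 0" using scale[of 0 \<eta>] by simp
    ultimately show ?thesis unfolding scale by simp
  qed
  have P_bound: "P (3 ^ k * u) \<le> 1 / 16 * (1 / 12) ^ k" for k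
  proof (induction k)
    case 0
    then show ?case using small by (simp add: P_def)
  next
    case (Suc k)
    let ?v = "3 ^ k * u"
    have "(1 / 12 :: real) ^ k \<le> 1" by (simp add: power_le_one)
    then have le: "P ?v \<le> 1 / 16" using Suc by linarith
    have "P (3 * ?v) * (1 - P ?v) \<le> (P ?v)\<^sup>2"
      unfolding P_def using u by (intro fernique_step meas tri scale) auto
    moreover have "P (3 * ?v) * (15 / 16) \<le> P (3 * ?v) * (1 - P ?v)"
      using le by (intro mult_left_mono) (auto simp: P_def)
    moreover have "(P ?v)\<^sup>2 \<le> P ?v * (1 / 16)"
      unfolding power2_eq_square using le by (intro mult_left_mono) (auto simp: P_def)
    moreover have "0 \<le> P ?v" by (simp add: P_def)
    \<comment> \<open>The preceding bounds give the factor 1/15; it is relaxed to 1/12 so that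
      multiplication by 9 yields 3/4.\<close>
    ultimately have "P (3 * ?v) \<le> P ?v * (1 / 12)" by simp
    then show ?case using Suc by (simp add: mult.assoc)
  qed
  have pointwise: "ennreal ((p \<eta>)\<^sup>2) \<le> ennreal (u\<^sup>2)
      + (\<Sum>k. ennreal ((3 ^ Suc k * u)\<^sup>2) * indicator {\<eta>. p \<eta> > 3 ^ k * u} \<eta>)" (is "_ \<le> _ + (\<Sum>k. ?f k)") for \<eta>
  proof (cases "p \<eta> \<le> u")
    case True
    then have "ennreal ((p \<eta>)\<^sup>2) \<le> ennreal (u\<^sup>2)"
      using nonneg by (intro ennreal_leI power_mono) auto
    then show ?thesis by (simp add: add_increasing2)
  next
    case False
    have "\<exists>k. p \<eta> \<le> 3 ^ k * u"
    proof -
      obtain k where "p \<eta> / u < 3 ^ k" using real_arch_pow[of 3 "p \<eta> / u"] by auto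
      then show ?thesis using u by (auto intro!: exI[of _ k] simp: field_simps)
    qed
    \<comment> \<open>The least such index locates the shell of \<open>\<eta>\<close>: it is
      nonzero, and its predecessor is the index of a single term that already dominates the
      square.\<close>
    define m where "m = (LEAST k. p \<eta> \<le> 3 ^ k * u)"
    have m: "p \<eta> \<le> 3 ^ m * u"
      unfolding m_def using \<open>\<exists>k. _\<close> by (rule LeastI_ex)
    have "m \<noteq> 0" using m False by (intro notI) simp
    then obtain k where k: "m = Suc k" using not0_implies_Suc by blast
    then have "p \<eta> > 3 ^ k * u"
      using not_less_Least[of k "\<lambda>k. p \<eta> \<le> 3 ^ k * u"] by (simp add: m_def)
    then have "ennreal ((p \<eta>)\<^sup>2) \<le> ?f k"
      using m nonneg unfolding k by (auto intro!: ennreal_leI power_mono)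
    also have "?f k = (\<Sum>k\<in>{k}. ?f k)"
      by (subst sum.insert) simp_all
    also have "\<dots> \<le> (\<Sum>k. ?f k)"
      by (intro sum_le_suminf summableI) auto
    finally show ?thesis by (simp add: add_increasing)
  qed
  \<comment> \<open>This series contributes \<open>9 / 4 * u\<^sup>2\<close>; with the
    \<open>u\<^sup>2\<close> of the inner ball the total is \<open>13 / 4 * u\<^sup>2\<close>,
    rounded up to 4 in the claim.\<close>
  have sum: "(\<lambda>k. 9 / 16 * u\<^sup>2 * (3 / 4) ^ k) sums (9 / 16 * u\<^sup>2 * 4)"
    using geometric_sums[of "3 / 4 :: real"] by (intro sums_mult) simp
  have "(\<integral>\<^sup>+z. ennreal ((p (Lam z))\<^sup>2) \<partial>\<mu>)
      \<le> (\<integral>\<^sup>+z. ennreal (u\<^sup>2) + (\<Sum>k. ennreal ((3 ^ Suc k * u)\<^sup>2) * indicator {z. p (Lam z) > 3 ^ k * u} z) \<partial>\<mu>)"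
    using pointwise by (intro nn_integral_mono) (simp add: indicator_def)
  also have "\<dots> = ennreal (u\<^sup>2) + (\<Sum>k. ennreal ((3 ^ Suc k * u)\<^sup>2) * emeasure \<mu> {z. p (Lam z) > 3 ^ k * u})"
    by (subst nn_integral_add, simp, simp, subst nn_integral_suminf)
      (simp_all add: nn_integral_cmult_indicator emeasure_space_1[simplified])
  also have "\<dots> \<le> ennreal (u\<^sup>2) + (\<Sum>k. ennreal (9 / 16 * u\<^sup>2 * (3 / 4) ^ k))"
  proof (intro add_left_mono suminf_le allI summableI)
    fix k
    have "(3::real) ^ (k * 2) = 9 ^ k" by (simp add: mult.commute[of k] power_mult)
    then have sq: "(3 ^ Suc k * u)\<^sup>2 = 9 * 9 ^ k * u\<^sup>2"
      by (simp add: power_mult_distrib power_mult[symmetric])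
    have "(3 ^ Suc k * u)\<^sup>2 * P (3 ^ k * u) \<le> (3 ^ Suc k * u)\<^sup>2 * (1 / 16 * (1 / 12) ^ k)"
      by (intro mult_left_mono P_bound) auto
    also have "\<dots> = 9 / 16 * u\<^sup>2 * (9 ^ k * (1 / 12) ^ k)"
      unfolding sq by simp
    also have "(9 ^ k * (1 / 12) ^ k :: real) = (3 / 4) ^ k"
      by (simp add: power_mult_distrib[symmetric])
    finally have "(3 ^ Suc k * u)\<^sup>2 * P (3 ^ k * u) \<le> 9 / 16 * u\<^sup>2 * (3 / 4) ^ k" .
    then show "ennreal ((3 ^ Suc k * u)\<^sup>2) * emeasure \<mu> {z. p (Lam z) > 3 ^ k * u} \<le> ennreal (9 / 16 * u\<^sup>2 * (3 / 4) ^ k)"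
      by (subst emeasure_eq_measure, subst ennreal_mult'[symmetric]) (simp_all only: P_def ennreal_leI zero_le_power2)
  qed
  also have "\<dots> = ennreal (u\<^sup>2) + ennreal (9 / 16 * u\<^sup>2 * 4)"
    using sum by (subst suminf_ennreal_eq) auto
  also have "\<dots> \<le> ennreal (4 * u\<^sup>2)"
    by (simp flip: ennreal_plus add: ennreal_leI)
  finally show ?thesis .
qed

subsection \<open>The square of the seminorm\<close>

text \<open>In terms of the context, \<open>T n (Lam z)\<close> is the \<open>n\<close>-th projection of \<open>z\<close> and \<open>G (Lam z)\<close> is
  the square of \<open>q z\<close>. As functions on the sequence space these are measurable for
  the product sigma algebra, whereas addition on \<open>E\<close> has no measurability lemma because \<open>E\<close>
  is not an instance of \<open>second_countable_topology\<close>.\<close>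

definition T :: "nat \<Rightarrow> (nat \<Rightarrow> real) \<Rightarrow> 'e" where
  "T n \<eta> = j (\<Sum>k<N n. \<eta> k *\<^sub>R e k)"

definition D :: "nat \<Rightarrow> (nat \<Rightarrow> real) \<Rightarrow> real" where
  "D n \<eta> = norm (T (Suc n) \<eta> - T n \<eta>)"

definition G :: "(nat \<Rightarrow> real) \<Rightarrow> ennreal" where
  "G \<eta> = (\<Sum>n. ennreal (2 ^ n * (D n \<eta>)\<^sup>2)) + (\<Sum>n. ennreal (dyadic_weight n * \<bar>\<eta> n\<bar>))\<^sup>2"

lemma T_eq_sum: "T n \<eta> = (\<Sum>k<N n. \<eta> k *\<^sub>R j (e k))"
  unfolding T_def using embedding_bounded_linear by (simp add: linear_sum linear_simps bounded_linear.linear)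

lemma T_add: "T n (\<lambda>k. \<eta> k + \<zeta> k) = T n \<eta> + T n \<zeta>"
  by (simp add: T_eq_sum scaleR_left_distrib sum.distrib)

lemma T_scale: "T n (\<lambda>k. c * \<eta> k) = c *\<^sub>R T n \<eta>"
  by (simp add: T_eq_sum scaleR_sum_right)

lemma D_triangle: "D n (\<lambda>k. \<eta> k + \<zeta> k) \<le> D n \<eta> + D n \<zeta>"
  unfolding D_def T_add
  using norm_triangle_ineq[of "T (Suc n) \<eta> - T n \<eta>" "T (Suc n) \<zeta> - T n \<zeta>"] by (simp add: algebra_simps)

lemma D_scale: "D n (\<lambda>k. c * \<eta> k) = \<bar>c\<bar> * D n \<eta>"
  by (simp add: D_def T_scale scaleR_diff_right[symmetric])

lemma D_nonneg [simp]: "0 \<le> D n \<eta>"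
  by (simp add: D_def)

lemma measurable_D [measurable]: "D n \<in> borel_measurable S"
proof -
  have "continuous_on UNIV (\<lambda>h. norm (j h))"
    by (intro continuous_intros linear_continuous_on embedding_bounded_linear)
  then have [measurable]: "(\<lambda>h. norm (j h)) \<in> borel_measurable borel"
    by (rule borel_measurable_continuous_onI)
  have "D n = (\<lambda>\<eta>. norm (j ((\<Sum>k<N (Suc n). \<eta> k *\<^sub>R e k) - (\<Sum>k<N n. \<eta> k *\<^sub>R e k))))"
    using embedding_bounded_linear by (simp add: D_def T_def linear_simps fun_eq_iff)
  also have "\<dots> \<in> borel_measurable S"
    by measurable
  finally show ?thesis .
qed

lemma measurable_G [measurable]: "G \<in> borel_measurable S"
  unfolding G_def by measurable

text \<open>\<open>G\<close> is built from squares of seminorms, and the square of a sum is at most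
  twice the sum of the squares. For the increments this is applied in each term, for the weighted
  coordinates only after summation.\<close>

lemma G_add_le: "G (\<lambda>k. \<eta> k + a * \<zeta> k) \<le> 2 * G \<eta> + ennreal (2 * a\<^sup>2) * G \<zeta>"
proof -
  let ?d = "\<lambda>\<eta> n. ennreal (2 ^ n * (D n \<eta>)\<^sup>2)" and ?w = "\<lambda>\<eta> n. ennreal (dyadic_weight n * \<bar>\<eta> n\<bar>)"
  have "(\<Sum>n. ?d (\<lambda>k. \<eta> k + a * \<zeta> k) n) \<le> (\<Sum>n. 2 * ?d \<eta> n + ennreal (2 * a\<^sup>2) * ?d \<zeta> n)"
  proof (intro suminf_le allI summableI)
    fix n
    have "D n (\<lambda>k. \<eta> k + a * \<zeta> k) \<le> D n \<eta> + \<bar>a\<bar> * D n \<zeta>"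
      using D_triangle[of n \<eta> "\<lambda>k. a * \<zeta> k"] by (simp add: D_scale)
    then have "(D n (\<lambda>k. \<eta> k + a * \<zeta> k))\<^sup>2 \<le> (D n \<eta> + \<bar>a\<bar> * D n \<zeta>)\<^sup>2"
      by (intro power_mono) auto
    also have "\<dots> \<le> 2 * (D n \<eta>)\<^sup>2 + 2 * (\<bar>a\<bar> * D n \<zeta>)\<^sup>2"
      using sum_squares_bound[of "D n \<eta>" "\<bar>a\<bar> * D n \<zeta>"] by (simp add: power2_sum)
    finally have "2 ^ n * (D n (\<lambda>k. \<eta> k + a * \<zeta> k))\<^sup>2 \<le> 2 ^ n * (2 * (D n \<eta>)\<^sup>2 + 2 * (\<bar>a\<bar> * D n \<zeta>)\<^sup>2)"
      by simp
    also have "\<dots> = 2 * (2 ^ n * (D n \<eta>)\<^sup>2) + 2 * a\<^sup>2 * (2 ^ n * (D n \<zeta>)\<^sup>2)"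
      by (simp add: power_mult_distrib algebra_simps)
    finally have "ennreal (2 ^ n * (D n (\<lambda>k. \<eta> k + a * \<zeta> k))\<^sup>2)
        \<le> ennreal (2 * (2 ^ n * (D n \<eta>)\<^sup>2) + 2 * a\<^sup>2 * (2 ^ n * (D n \<zeta>)\<^sup>2))"
      by (rule ennreal_leI)
    then show "?d (\<lambda>k. \<eta> k + a * \<zeta> k) n \<le> 2 * ?d \<eta> n + ennreal (2 * a\<^sup>2) * ?d \<zeta> n"
      by (simp add: ennreal_mult)
  qed
  also have "\<dots> = 2 * (\<Sum>n. ?d \<eta> n) + ennreal (2 * a\<^sup>2) * (\<Sum>n. ?d \<zeta> n)"
    by (simp add: suminf_add[symmetric] summableI)
  finally have d: "(\<Sum>n. ?d (\<lambda>k. \<eta> k + a * \<zeta> k) n) \<le> 2 * (\<Sum>n. ?d \<eta> n) + ennreal (2 * a\<^sup>2) * (\<Sum>n. ?d \<zeta> n)" .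
  have "(\<Sum>n. ?w (\<lambda>k. \<eta> k + a * \<zeta> k) n) \<le> (\<Sum>n. ?w \<eta> n + ennreal \<bar>a\<bar> * ?w \<zeta> n)"
  proof (intro suminf_le allI summableI)
    fix n
    have "dyadic_weight n * \<bar>\<eta> n + a * \<zeta> n\<bar> \<le> dyadic_weight n * (\<bar>\<eta> n\<bar> + \<bar>a\<bar> * \<bar>\<zeta> n\<bar>)"
      using dyadic_weight_pos[of n] abs_triangle_ineq[of "\<eta> n" "a * \<zeta> n"] by (simp add: abs_mult)
    also have "\<dots> = dyadic_weight n * \<bar>\<eta> n\<bar> + \<bar>a\<bar> * (dyadic_weight n * \<bar>\<zeta> n\<bar>)"
      by (simp add: algebra_simps)
    finally have "ennreal (dyadic_weight n * \<bar>\<eta> n + a * \<zeta> n\<bar>)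
        \<le> ennreal (dyadic_weight n * \<bar>\<eta> n\<bar> + \<bar>a\<bar> * (dyadic_weight n * \<bar>\<zeta> n\<bar>))"
      by (rule ennreal_leI)
    then show "?w (\<lambda>k. \<eta> k + a * \<zeta> k) n \<le> ?w \<eta> n + ennreal \<bar>a\<bar> * ?w \<zeta> n"
      using dyadic_weight_pos[of n] by (simp add: ennreal_mult less_imp_le)
  qed
  also have "\<dots> = (\<Sum>n. ?w \<eta> n) + ennreal \<bar>a\<bar> * (\<Sum>n. ?w \<zeta> n)"
    by (simp add: suminf_add[symmetric] summableI)
  finally have "(\<Sum>n. ?w (\<lambda>k. \<eta> k + a * \<zeta> k) n)\<^sup>2 \<le> ((\<Sum>n. ?w \<eta> n) + ennreal \<bar>a\<bar> * (\<Sum>n. ?w \<zeta> n))\<^sup>2"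
    by (intro power_mono) auto
  also have "\<dots> \<le> 2 * (\<Sum>n. ?w \<eta> n)\<^sup>2 + 2 * (ennreal \<bar>a\<bar> * (\<Sum>n. ?w \<zeta> n))\<^sup>2"
    by (rule ennreal_add_power2_le)
  also have "2 * (ennreal \<bar>a\<bar> * (\<Sum>n. ?w \<zeta> n))\<^sup>2 = ennreal (2 * a\<^sup>2) * (\<Sum>n. ?w \<zeta> n)\<^sup>2"
    by (simp add: power_mult_distrib ennreal_power ennreal_mult mult.assoc)
  finally have w: "(\<Sum>n. ?w (\<lambda>k. \<eta> k + a * \<zeta> k) n)\<^sup>2 \<le> 2 * (\<Sum>n. ?w \<eta> n)\<^sup>2 + ennreal (2 * a\<^sup>2) * (\<Sum>n. ?w \<zeta> n)\<^sup>2" .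
  show ?thesis
    unfolding G_def using add_mono[OF d w] by (simp add: distrib_left add_ac)
qed

section \<open>Second moments and integrability of \<open>G\<close>\<close>

lemma second_moment_L: "(\<integral>\<^sup>+z. ennreal ((L k z)\<^sup>2) \<partial>\<mu>) = 1"
proof -
  obtain h where h: "riesz_rep j (L k) h" "distr \<mu> borel (L k) = normal_law 0 (norm h)"
    using gaussian[OF bounded_linear_L] by blast
  have "h = e k"
    using h(1) dual[of k] by (intro vector_eq_rdot[THEN iffD1]) (simp add: riesz_rep_def)
  then have "norm h = 1" using orthonormal[of k k] by (simp add: norm_eq_sqrt_inner)
  then have law: "distr \<mu> borel (L k) = std_normal_distribution"
    using h(2) by (simp add: normal_law_def)
  have "(\<integral>\<^sup>+z. ennreal ((L k z)\<^sup>2) \<partial>\<mu>) = (\<integral>\<^sup>+x. ennreal (x\<^sup>2) \<partial>std_normal_distribution)"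
    by (subst law[symmetric], subst nn_integral_distr) auto
  also have "\<dots> = (\<integral>\<^sup>+x. ennreal (std_normal_density x * x\<^sup>2) \<partial>lborel)"
    by (subst nn_integral_density) (auto simp: ennreal_mult)
  also have "\<dots> = 1"
    using std_normal_moment_even[of 1]
    by (subst nn_integral_eq_integral) (auto simp: has_bochner_integral_iff)
  finally show ?thesis .
qed

text \<open>Each increment involves finitely many coordinates. The quantitative bound below starts
  at \<open>n = 5\<close>; this one takes care of the first terms.\<close>

lemma second_moment_D_finite: "(\<integral>\<^sup>+z. ennreal ((D n (Lam z))\<^sup>2) \<partial>\<mu>) < \<infinity>"
proof -
  let ?I = "{..<N (Suc n)} - {..<N n}"
  define C where "C = (\<Sum>k\<in>?I. (norm (j (e k)))\<^sup>2)"
  have C: "0 \<le> C" by (simp add: C_def sum_nonneg)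
  have "(D n \<eta>)\<^sup>2 \<le> C * (\<Sum>k\<in>?I. (\<eta> k)\<^sup>2)" for \<eta>
  proof -
    have "N n \<le> N (Suc n)" using N_mono by (simp add: strict_mono_Suc_iff less_imp_le)
    then have "T (Suc n) \<eta> - T n \<eta> = (\<Sum>k\<in>?I. \<eta> k *\<^sub>R j (e k))"
      unfolding T_eq_sum by (subst sum_diff) auto
    then have "D n \<eta> \<le> (\<Sum>k\<in>?I. norm (j (e k)) * \<bar>\<eta> k\<bar>)"
      unfolding D_def by (auto intro!: sum_norm_le simp: mult.commute)
    then have "(D n \<eta>)\<^sup>2 \<le> (\<Sum>k\<in>?I. norm (j (e k)) * \<bar>\<eta> k\<bar>)\<^sup>2"
      by (intro power_mono) auto
    also have "\<dots> \<le> C * (\<Sum>k\<in>?I. \<bar>\<eta> k\<bar>\<^sup>2)"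
      unfolding C_def by (rule Cauchy_Schwarz_ineq_sum)
    finally show ?thesis by simp
  qed
  then have "(\<integral>\<^sup>+z. ennreal ((D n (Lam z))\<^sup>2) \<partial>\<mu>) \<le> (\<integral>\<^sup>+z. ennreal C * (\<Sum>k\<in>?I. ennreal ((L k z)\<^sup>2)) \<partial>\<mu>)"
    using C unfolding Lam_def
    by (intro nn_integral_mono) (simp add: ennreal_mult'[symmetric] sum_ennreal sum_nonneg ennreal_leI del: lessThan_minus_lessThan)
  also have "\<dots> = ennreal C * of_nat (card ?I)"
    by (subst nn_integral_cmult, simp, subst nn_integral_sum) (simp_all add: second_moment_L del: lessThan_minus_lessThan sum_ennreal)
  also have "\<dots> < \<infinity>" by (simp add: ennreal_mult_less_top of_nat_less_top)
  finally show ?thesis .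
qed

text \<open>An increment larger than \<open>u\<close> forces one of two consecutive approximations
  to miss its tolerance. The two exceptional probabilities add up to at most
  \<open>2 * (1 / 2) ^ n\<close>, and \<open>n = 5\<close> is where this reaches the 1/16 asked for
  by \<open>fernique_second_moment\<close>.\<close>

lemma second_moment_D_le:
  assumes "5 \<le> n"
  shows "(\<integral>\<^sup>+z. ennreal ((D n (Lam z))\<^sup>2) \<partial>\<mu>) \<le> ennreal (16 * (1 / 4) ^ n)"
proof -
  define u where "u = 2 * (1 / 2 :: real) ^ n"
  let ?B = "\<lambda>n. {z. norm (z - T n (Lam z)) > (1 / 2) ^ n}"
  have B: "?B m \<in> sets \<mu>" for m
  proof -
    have "continuous_on UNIV (\<lambda>z. norm (z - T m (Lam z)))"
      unfolding T_eq_sum Lam_def by (intro continuous_intros continuous_L)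
    then have [measurable]: "(\<lambda>z. norm (z - T m (Lam z))) \<in> borel_measurable borel"
      by (rule borel_measurable_continuous_onI)
    show ?thesis by measurable
  qed
  have tail': "prob (?B m) \<le> (1 / 2) ^ m" if "1 \<le> m" for m
    using tail[OF that] by (simp add: T_def Lam_def)
  have "{z. D n (Lam z) > u} \<subseteq> ?B n \<union> ?B (Suc n)"
  proof (rule subsetI, rule ccontr)
    fix z assume z: "z \<in> {z. D n (Lam z) > u}" "z \<notin> ?B n \<union> ?B (Suc n)"
    have "D n (Lam z) \<le> norm (z - T n (Lam z)) + norm (z - T (Suc n) (Lam z))"
      unfolding D_def using norm_triangle_ineq4[of "z - T n (Lam z)" "z - T (Suc n) (Lam z)"] by simp
    also have "\<dots> \<le> (1 / 2) ^ n + (1 / 2) ^ Suc n"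
      using z(2) by (intro add_mono) (auto simp: not_less)
    also have "\<dots> \<le> u" by (simp add: u_def)
    finally show False using z(1) by simp
  qed
  then have "prob {z. D n (Lam z) > u} \<le> prob (?B n \<union> ?B (Suc n))"
    using B[of n] B[of "Suc n"] by (intro finite_measure_mono sets.Un)
  also have "\<dots> \<le> prob (?B n) + prob (?B (Suc n))"
    using B by (intro measure_Un_le)
  also have "\<dots> \<le> (1 / 2) ^ n + (1 / 2) ^ Suc n"
    using assms by (intro add_mono tail') auto
  also have "\<dots> \<le> 2 * (1 / 2) ^ n" by simp
  also have "\<dots> \<le> 2 * (1 / 2) ^ 5"
    using assms by (intro mult_left_mono power_decreasing) auto
  finally have "prob {z. D n (Lam z) > u} \<le> 1 / 16" by (simp add: power_divide)
  then have "(\<integral>\<^sup>+z. ennreal ((D n (Lam z))\<^sup>2) \<partial>\<mu>) \<le> ennreal (4 * u\<^sup>2)"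
    by (intro fernique_second_moment measurable_D D_triangle D_scale) (auto simp: u_def)
  also have "4 * u\<^sup>2 = 16 * (1 / 4) ^ n"
  proof -
    have "((1 / 2 :: real) ^ n)\<^sup>2 = (1 / 4) ^ n"
      by (simp add: power_mult[symmetric] mult.commute[of n]) (simp add: power_mult power_divide)
    then show ?thesis by (simp add: u_def power_mult_distrib)
  qed
  finally show ?thesis .
qed

definition mean_G :: ennreal where
  "mean_G = (\<integral>\<^sup>+z. G (Lam z) \<partial>\<mu>)"

lemma mean_G_finite: "mean_G < \<infinity>"
proof -
  define f where "f n = (\<integral>\<^sup>+z. ennreal (2 ^ n * (D n (Lam z))\<^sup>2) \<partial>\<mu>)" for n
  have f: "f n = ennreal (2 ^ n) * (\<integral>\<^sup>+z. ennreal ((D n (Lam z))\<^sup>2) \<partial>\<mu>)" for n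
    by (simp add: f_def ennreal_mult nn_integral_cmult)
  \<comment> \<open>Adding the first five terms explicitly yields one majorant valid for every
    \<open>n\<close>; the factor \<open>2 ^ n\<close> still leaves geometric decay against
    \<open>(1 / 4) ^ n\<close>.\<close>
  have f_le: "f n \<le> ennreal (16 * (1 / 2) ^ n) + (if n \<in> {..<5} then f n else 0)" for n
  proof (cases "n < 5")
    case False
    then have "f n \<le> ennreal (2 ^ n) * ennreal (16 * (1 / 4) ^ n)"
      unfolding f by (intro mult_left_mono second_moment_D_le) auto
    also have "\<dots> = ennreal (16 * (2 ^ n * (1 / 4) ^ n))"
      by (simp add: ennreal_mult'[symmetric])
    also have "2 ^ n * (1 / 4) ^ n = (1 / 2 :: real) ^ n"
      by (simp add: power_mult_distrib[symmetric])
    finally show ?thesis by (simp add: add_increasing2)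
  qed (simp add: add_increasing)
  have "(\<Sum>n. f n) \<le> (\<Sum>n. ennreal (16 * (1 / 2) ^ n) + (if n \<in> {..<5} then f n else 0))"
    using f_le by (intro suminf_le summableI) auto
  also have "\<dots> = (\<Sum>n. ennreal (16 * (1 / 2) ^ n)) + (\<Sum>n. if n \<in> {..<5} then f n else 0)"
    by (rule suminf_add[symmetric]) (auto intro: summableI)
  also have "(\<Sum>n. if n \<in> {..<5} then f n else 0) = (\<Sum>n<5. f n)"
    by (subst suminf_finite[of "{..<5}"]) auto
  also have "(\<Sum>n. ennreal (16 * (1 / 2) ^ n)) = ennreal (\<Sum>n. 16 * (1 / 2) ^ n)"
    by (intro suminf_ennreal2 summable_mult summable_geometric) auto
  also have "ennreal (\<Sum>n. 16 * (1 / 2) ^ n) + (\<Sum>n<5. f n) < \<infinity>"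
    using second_moment_D_finite by (auto simp: f ennreal_mult_less_top)
  finally have first: "(\<Sum>n. f n) < \<infinity>" .
  have "(\<integral>\<^sup>+z. (\<Sum>n. ennreal (dyadic_weight n * \<bar>Lam z n\<bar>))\<^sup>2 \<partial>\<mu>)
      \<le> (\<integral>\<^sup>+z. (\<Sum>n. ennreal (dyadic_weight n)) * (\<Sum>n. ennreal (dyadic_weight n * (Lam z n)\<^sup>2)) \<partial>\<mu>)"
    by (intro nn_integral_mono weighted_cauchy_schwarz)
  also have "\<dots> = (\<Sum>n. ennreal (dyadic_weight n)) * (\<Sum>n. ennreal (dyadic_weight n))"
    using dyadic_weight_pos
    by (simp add: nn_integral_cmult nn_integral_suminf ennreal_mult less_imp_le Lam_def second_moment_L)
  also have "\<dots> < \<infinity>"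
    using suminf_dyadic_weight_finite by (simp add: ennreal_mult_less_top)
  finally have second: "(\<integral>\<^sup>+z. (\<Sum>n. ennreal (dyadic_weight n * \<bar>Lam z n\<bar>))\<^sup>2 \<partial>\<mu>) < \<infinity>" .
  have "mean_G = (\<Sum>n. f n) + (\<integral>\<^sup>+z. (\<Sum>n. ennreal (dyadic_weight n * \<bar>Lam z n\<bar>))\<^sup>2 \<partial>\<mu>)"
    unfolding mean_G_def G_def f_def
    by (subst nn_integral_add, measurable, subst nn_integral_suminf) auto
  then show ?thesis using first second by simp
qed

section \<open>Compactness of the sublevel sets of \<open>G\<close>\<close>

lemma G_bounds:
  assumes "G (Lam z) \<le> ennreal \<alpha>" "0 < \<alpha>"
  shows "D n (Lam z) \<le> sqrt \<alpha> * sqrt (1 / 2) ^ n"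
    and "\<bar>L k z\<bar> \<le> sqrt \<alpha> / dyadic_weight k"
proof -
  have "ennreal (2 ^ n * (D n (Lam z))\<^sup>2) = (\<Sum>n\<in>{n}. ennreal (2 ^ n * (D n (Lam z))\<^sup>2))" by (subst sum.insert) auto
  also have "\<dots> \<le> (\<Sum>n. ennreal (2 ^ n * (D n (Lam z))\<^sup>2))"
    by (intro sum_le_suminf summableI) auto
  also have "\<dots> \<le> G (Lam z)" by (simp add: G_def)
  also have "\<dots> \<le> ennreal \<alpha>" by fact
  finally have "2 ^ n * (D n (Lam z))\<^sup>2 \<le> \<alpha>" using assms(2) by simp
  then have "(D n (Lam z))\<^sup>2 \<le> \<alpha> * (1 / 2) ^ n" by (simp add: field_simps power_divide)
  then have "sqrt ((D n (Lam z))\<^sup>2) \<le> sqrt (\<alpha> * (1 / 2) ^ n)" by (rule real_sqrt_le_mono)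
  then show "D n (Lam z) \<le> sqrt \<alpha> * sqrt (1 / 2) ^ n"
    by (simp add: real_sqrt_mult real_sqrt_power)
  have "ennreal (dyadic_weight k * \<bar>Lam z k\<bar>) = (\<Sum>k\<in>{k}. ennreal (dyadic_weight k * \<bar>Lam z k\<bar>))"
    by (subst sum.insert) auto
  also have "\<dots> \<le> (\<Sum>k. ennreal (dyadic_weight k * \<bar>Lam z k\<bar>))"
    by (intro sum_le_suminf summableI) auto
  finally have "(ennreal (dyadic_weight k * \<bar>Lam z k\<bar>))\<^sup>2 \<le> (\<Sum>k. ennreal (dyadic_weight k * \<bar>Lam z k\<bar>))\<^sup>2"
    by (intro power_mono) auto
  also have "\<dots> \<le> G (Lam z)" by (simp add: G_def)
  also have "\<dots> \<le> ennreal \<alpha>" by fact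
  finally have "(dyadic_weight k * \<bar>Lam z k\<bar>)\<^sup>2 \<le> \<alpha>"
    using assms(2) dyadic_weight_pos[of k] by (simp add: ennreal_power less_imp_le)
  then have "dyadic_weight k * \<bar>Lam z k\<bar> \<le> sqrt \<alpha>" by (rule real_le_rsqrt)
  then show "\<bar>L k z\<bar> \<le> sqrt \<alpha> / dyadic_weight k"
    using dyadic_weight_pos[of k] by (simp add: Lam_def field_simps abs_mult)
qed

lemma L_T: "L k (T n (Lam z)) = (if k < N n then L k z else 0)"
proof -
  have "L k (T n (Lam z)) = (\<Sum>i<N n. Lam z i * L k (j (e i)))"
    unfolding T_eq_sum using bounded_linear_L[of k]
    by (simp add: linear_sum bounded_linear.linear L_scale)
  then show ?thesis by (simp add: L_e Lam_def if_distrib[of "\<lambda>x. _ * x"] cong: if_cong)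
qed

text \<open>On the sublevel set the increments are dominated by a geometric series, and the error is
  the tail of that series. The bound depends on \<open>z\<close> only through
  \<open>\<alpha>\<close>, hence is uniform.\<close>

lemma norm_diff_T_le:
  assumes "G (Lam z) \<le> ennreal \<alpha>" "0 < \<alpha>"
  shows "norm (z - T n (Lam z)) \<le> sqrt \<alpha> * sqrt (1 / 2) ^ n / (1 - sqrt (1 / 2))"
proof -
  define \<rho> where "\<rho> = sqrt (1 / 2 :: real)"
  have \<rho>: "0 < \<rho>" "\<rho> < 1" by (simp_all add: \<rho>_def real_sqrt_divide)
  define d where "d i = T (Suc i) (Lam z) - T i (Lam z)" for i
  have d_le: "norm (d i) \<le> sqrt \<alpha> * \<rho> ^ i" for i
    using G_bounds(1)[OF assms, of i] by (simp add: d_def D_def \<rho>_def)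
  have geom: "summable (\<lambda>i. sqrt \<alpha> * \<rho> ^ i)"
    using \<rho> by (intro summable_mult summable_geometric) auto
  have sum_norm: "summable (\<lambda>i. norm (d i))"
    by (rule summable_comparison_test'[OF geom, of 0]) (use d_le in auto)
  then have "summable d" by (rule summable_norm_cancel)
  have T: "T n (Lam z) = (\<Sum>i<n. d i)" for n
    by (induction n) (auto simp: d_def T_eq_sum N_0)
  have "(\<lambda>n. T n (Lam z)) \<longlonglongrightarrow> suminf d"
    unfolding T using \<open>summable d\<close> by (rule summable_LIMSEQ)
  \<comment> \<open>Completeness provides some limit; it is \<open>z\<close> because every
    coordinate of the approximations is eventually that of \<open>z\<close> and the coordinates
    separate points.\<close>
  have "suminf d = z"
  proof (rule separates)
    fix k
    have "(\<lambda>n. L k (T n (Lam z))) \<longlonglongrightarrow> L k (suminf d)"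
      by (rule bounded_linear.tendsto[OF bounded_linear_L]) fact
    moreover have "eventually (\<lambda>n. L k (T n (Lam z)) = L k z) sequentially"
      using eventually_gt_at_top[of k]
    proof eventually_elim
      case (elim n)
      moreover have "n \<le> N n" by (rule strict_mono_imp_increasing[OF N_mono])
      ultimately show ?case by (simp add: L_T)
    qed
    then have "(\<lambda>n. L k (T n (Lam z))) \<longlonglongrightarrow> L k z" by (rule tendsto_eventually)
    ultimately show "L k (suminf d) = L k z" by (rule LIMSEQ_unique)
  qed
  then have "z - T n (Lam z) = (\<Sum>i. d (i + n))"
    using suminf_split_initial_segment[OF \<open>summable d\<close>, of n] by (simp add: T algebra_simps)
  also have "norm \<dots> \<le> (\<Sum>i. norm (d (i + n)))"
    by (intro summable_norm summable_ignore_initial_segment[OF sum_norm])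
  also have "\<dots> \<le> (\<Sum>i. sqrt \<alpha> * \<rho> ^ (i + n))"
    by (intro suminf_le d_le summable_ignore_initial_segment[OF sum_norm] summable_ignore_initial_segment[OF geom])
  also have "\<dots> = (\<Sum>i. (sqrt \<alpha> * \<rho> ^ n) * \<rho> ^ i)"
    by (simp add: power_add mult_ac)
  also have "\<dots> = sqrt \<alpha> * \<rho> ^ n / (1 - \<rho>)"
    using \<rho> by (subst suminf_mult) (auto intro!: summable_geometric simp: suminf_geometric)
  finally show ?thesis unfolding \<rho>_def .
qed

lemma compact_closure_sublevel_G:
  assumes "0 < \<alpha>"
  shows "compact (closure {z. G (Lam z) \<le> ennreal \<alpha>})"
proof (rule compact_closure_if_totally_bounded)
  fix \<epsilon> :: real assume \<epsilon>: "0 < \<epsilon>"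
  have "(\<lambda>n. sqrt \<alpha> * sqrt (1 / 2) ^ n / (1 - sqrt (1 / 2))) \<longlonglongrightarrow> sqrt \<alpha> * 0 / (1 - sqrt (1 / 2))"
    by (intro tendsto_intros LIMSEQ_realpow_zero) (auto simp: real_sqrt_divide)
  then have "eventually (\<lambda>n. sqrt \<alpha> * sqrt (1 / 2) ^ n / (1 - sqrt (1 / 2)) < \<epsilon> / 2) sequentially"
    using \<epsilon> by (intro order_tendstoD(2)[where y = "sqrt \<alpha> * 0 / (1 - sqrt (1 / 2))"]) simp_all
  then obtain n where n: "sqrt \<alpha> * sqrt (1 / 2) ^ n / (1 - sqrt (1 / 2)) < \<epsilon> / 2"
    by (auto simp: eventually_sequentially)
  \<comment> \<open>This box contains all approximations \<open>T n (Lam z)\<close>. Half of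
    \<open>\<epsilon>\<close> is spent on a finite net for it, the other half on the distance from
    \<open>z\<close> to its approximation.\<close>
  define B where "B = {\<Sum>k<N n. c k *\<^sub>R j (e k) | c. \<forall>k<N n. \<bar>c k\<bar> \<le> sqrt \<alpha> / dyadic_weight k}"
  have "compact B" unfolding B_def by (rule compact_box_sum)
  then obtain K where K: "finite K" "B \<subseteq> (\<Union>x\<in>K. ball x (\<epsilon> / 2))"
    using \<epsilon> unfolding compact_eq_totally_bounded by (meson half_gt_zero)
  have "{z. G (Lam z) \<le> ennreal \<alpha>} \<subseteq> (\<Union>x\<in>K. ball x \<epsilon>)"
  proof clarify
    fix z assume z: "G (Lam z) \<le> ennreal \<alpha>"
    have "T n (Lam z) \<in> B"
      unfolding B_def T_eq_sum Lam_def using G_bounds(2)[OF z assms] by auto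
    then obtain x where x: "x \<in> K" "dist x (T n (Lam z)) < \<epsilon> / 2"
      using K(2) by auto
    have "dist (T n (Lam z)) z < \<epsilon> / 2"
      using order.strict_trans1[OF norm_diff_T_le[OF z assms, of n] n]
      by (simp add: dist_norm norm_minus_commute)
    then have "dist x z < \<epsilon>"
      using x(2) dist_triangle[of x z "T n (Lam z)"] by linarith
    then show "z \<in> (\<Union>x\<in>K. ball x \<epsilon>)"
      using x(1) by auto
  qed
  then show "\<exists>K. finite K \<and> {z. G (Lam z) \<le> ennreal \<alpha>} \<subseteq> (\<Union>x\<in>K. ball x \<epsilon>)"
    using K(1) by blast
qed

subsection \<open>Semigroup and resolvent\<close>

text \<open>The semigroup in coordinates. No case distinction at \<open>t = 0\<close> occurs, since
  then the shift vanishes and \<open>\<mu>\<close> has mass 1.\<close>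

definition PS :: "real \<Rightarrow> ((nat \<Rightarrow> real) \<Rightarrow> ennreal) \<Rightarrow> (nat \<Rightarrow> real) \<Rightarrow> ennreal" where
  "PS t F \<eta> = (\<integral>\<^sup>+w. F (\<lambda>k. \<eta> k + sqrt t * L k w) \<partial>\<mu>)"

definition RU :: "real \<Rightarrow> ((nat \<Rightarrow> real) \<Rightarrow> ennreal) \<Rightarrow> (nat \<Rightarrow> real) \<Rightarrow> ennreal" where
  "RU a F \<eta> = (\<integral>\<^sup>+t\<in>{0..}. (ennreal (exp (- a * t)) * PS t F \<eta>) \<partial>lborel)"

lemma measurable_coordinates [measurable (raw)]:
  assumes [measurable]: "\<And>k. (\<lambda>x. f x k) \<in> borel_measurable M"
  shows "(\<lambda>x k. f x k :: real) \<in> measurable M S"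
  by (rule measurable_PiM_single') auto

lemma measurable_PS [measurable (raw)]:
  assumes [measurable]: "F \<in> borel_measurable S" "f \<in> borel_measurable M" "g \<in> measurable M S"
  shows "(\<lambda>x. PS (f x) F (g x)) \<in> borel_measurable M"
proof -
  have [measurable]: "(\<lambda>x. g x k) \<in> borel_measurable M" for k
    using measurable_component_singleton[of k UNIV "\<lambda>_. borel"] assms(3) by (auto intro: measurable_compose)
  show ?thesis
    unfolding PS_def by measurable
qed

lemma measurable_RU [measurable]:
  assumes [measurable]: "F \<in> borel_measurable S"
  shows "RU a F \<in> borel_measurable S"
  unfolding RU_def by measurable

lemma semigroup_P_eq_PS:
  assumes [measurable]: "F \<in> borel_measurable S" and "0 \<le> t"
  shows "semigroup_P \<mu> t (\<lambda>y. F (Lam (y - z))) y = PS t F (Lam (y - z))"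
proof -
  have shift: "Lam (y + c *\<^sub>R w - z) = (\<lambda>k. Lam (y - z) k + c * L k w)" for c w
    by (simp add: Lam_def fun_eq_iff L_add L_diff L_scale)
  show ?thesis
  proof (cases "t = 0")
    case True
    then show ?thesis
      using emeasure_space_1 by (simp add: semigroup_P_def PS_def)
  next
    case False
    have c: "continuous_on UNIV (\<lambda>w. L k (y + w - z))" for k
      by (intro continuous_on_compose2[OF continuous_L] continuous_intros) auto
    have m1: "(\<lambda>w. F (Lam (y + w - z))) \<in> borel_measurable borel"
      unfolding Lam_def using c[THEN borel_measurable_continuous_onI] by measurable
    have m2: "(\<lambda>w. sqrt t *\<^sub>R w) \<in> measurable \<mu> borel"
      unfolding measurable_cong_sets[OF sets_mu refl]
      by (intro borel_measurable_continuous_onI continuous_intros)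
    show ?thesis
      using False unfolding semigroup_P_def gauss_scaled_def PS_def
      by (simp add: nn_integral_distr[OF m2] m1 shift)
  qed
qed

lemma resolvent_U_eq_RU:
  assumes "F \<in> borel_measurable S"
  shows "resolvent_U \<mu> a (\<lambda>y. F (Lam (y - z))) y = RU a F (Lam (y - z))"
  unfolding resolvent_U_def RU_def
  by (intro nn_integral_cong) (simp add: semigroup_P_eq_PS[OF assms] indicator_def)

text \<open>By Fubini two successive steps are an integral over independent \<open>w\<close>, whose
  combined displacement has the law given by \<open>convolution_law\<close>.\<close>

lemma PS_PS:
  assumes [measurable]: "F \<in> borel_measurable S" and st: "0 \<le> s" "0 \<le> t"
  shows "(\<integral>\<^sup>+w. PS t F (\<lambda>k. \<eta> k + sqrt s * L k w) \<partial>\<mu>) = PS (s + t) F \<eta>"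
proof -
  have F': "(\<lambda>\<zeta>. F (\<lambda>k. \<eta> k + \<zeta> k)) \<in> borel_measurable S"
    by measurable
  have "(\<integral>\<^sup>+w. PS t F (\<lambda>k. \<eta> k + sqrt s * L k w) \<partial>\<mu>)
      = (\<integral>\<^sup>+p. F (\<lambda>k. \<eta> k + (sqrt s * L k (fst p) + sqrt t * L k (snd p))) \<partial>(\<mu> \<Otimes>\<^sub>M \<mu>))"
    unfolding PS_def by (subst nn_integral_fst[symmetric]) (simp_all add: add.assoc)
  also have "\<dots> = (\<integral>\<^sup>+\<zeta>. F (\<lambda>k. \<eta> k + \<zeta> k) \<partial>distr (\<mu> \<Otimes>\<^sub>M \<mu>) S (\<lambda>p k. sqrt s * L k (fst p) + sqrt t * L k (snd p)))"
    by (subst nn_integral_distr) (simp_all add: F')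
  also have "\<dots> = (\<integral>\<^sup>+\<zeta>. F (\<lambda>k. \<eta> k + \<zeta> k) \<partial>distr \<mu> S (\<lambda>w k. sqrt (s + t) * L k w))"
    using st by (subst convolution_law[of "sqrt (s + t)"]) auto
  also have "\<dots> = PS (s + t) F \<eta>"
    unfolding PS_def by (subst nn_integral_distr) (simp_all add: F')
  finally show ?thesis .
qed

text \<open>Since \<open>P\<^sub>s P\<^sub>t = P\<^sub>s\<^sub>+\<^sub>t\<close>, the substitution \<open>r = s + t\<close> turns the iterated resolvent
  into a single integral whose weight increases to \<open>exp (- r)\<close> with \<open>\<alpha>\<close>.\<close>

lemma RU_RU:
  assumes F [measurable]: "F \<in> borel_measurable S" and \<alpha>: "0 < \<alpha>"
  shows "ennreal \<alpha> * RU (1 + \<alpha>) (RU 1 F) \<eta>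
    = (\<integral>\<^sup>+r\<in>{0..}. (ennreal (1 - exp (- \<alpha> * r)) * (ennreal (exp (- r)) * PS r F \<eta>)) \<partial>lborel)"
proof -
  let ?h = "\<lambda>r. PS r F \<eta>"
  interpret lm: pair_sigma_finite lborel \<mu> ..
  have [measurable]: "Measurable.pred (lborel \<Otimes>\<^sub>M lborel) (\<lambda>x. snd x \<in> {0..fst x :: real})"
    unfolding atLeastAtMost_iff by measurable
  have joint: "(\<lambda>(r, s). ennreal (exp (- \<alpha> * s)) * indicator {0..r} s * (ennreal (exp (- r)) * ?h r * indicator {0..} r))
      \<in> borel_measurable (lborel \<Otimes>\<^sub>M lborel)"
    unfolding split_beta indicator_def by measurable
  have inner: "PS s (RU 1 F) \<eta> = (\<integral>\<^sup>+r. ennreal (exp (s - r)) * ?h r * indicator {s..} r \<partial>lborel)" if s: "0 \<le> s" for s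
  proof -
    have "PS s (RU 1 F) \<eta> = (\<integral>\<^sup>+t. \<integral>\<^sup>+w. ennreal (exp (- 1 * t)) * PS t F (\<lambda>k. \<eta> k + sqrt s * L k w) * indicator {0..} t \<partial>\<mu> \<partial>lborel)"
      unfolding RU_def PS_def[of s] by (rule lm.Fubini') measurable
    also have "\<dots> = (\<integral>\<^sup>+t. ennreal (exp (- t)) * ?h (s + t) * indicator {0..} t \<partial>lborel)"
    proof (intro nn_integral_cong)
      fix t :: real
      show "(\<integral>\<^sup>+w. ennreal (exp (- 1 * t)) * PS t F (\<lambda>k. \<eta> k + sqrt s * L k w) * indicator {0..} t \<partial>\<mu>)
          = ennreal (exp (- t)) * ?h (s + t) * indicator {0..} t"
      proof (cases "0 \<le> t")
        case True
        then show ?thesis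
          by (simp add: nn_integral_cmult PS_PS[OF F s])
      qed simp
    qed
    also have "\<dots> = (\<integral>\<^sup>+r. ennreal (exp (s - r)) * ?h r * indicator {s..} r \<partial>lborel)"
      by (subst nn_integral_real_affine[of _ 1 s]) (auto intro!: nn_integral_cong simp: indicator_def)
    finally show ?thesis .
  qed
  have "RU (1 + \<alpha>) (RU 1 F) \<eta>
      = (\<integral>\<^sup>+s. \<integral>\<^sup>+r. ennreal (exp (- \<alpha> * s)) * indicator {0..r} s * (ennreal (exp (- r)) * ?h r * indicator {0..} r) \<partial>lborel \<partial>lborel)"
    unfolding RU_def[of "1 + \<alpha>"]
  proof (intro nn_integral_cong)
    fix s :: real
    show "ennreal (exp (- (1 + \<alpha>) * s)) * PS s (RU 1 F) \<eta> * indicator {0..} s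
        = (\<integral>\<^sup>+r. ennreal (exp (- \<alpha> * s)) * indicator {0..r} s * (ennreal (exp (- r)) * ?h r * indicator {0..} r) \<partial>lborel)"
    proof (cases "0 \<le> s")
      case True
      have "ennreal (exp (- (1 + \<alpha>) * s)) * PS s (RU 1 F) \<eta> * indicator {0..} s
          = (\<integral>\<^sup>+r. ennreal (exp (- (1 + \<alpha>) * s)) * (ennreal (exp (s - r)) * ?h r * indicator {s..} r) \<partial>lborel)"
        using True by (simp add: inner nn_integral_cmult)
      also have "\<dots> = (\<integral>\<^sup>+r. ennreal (exp (- \<alpha> * s)) * indicator {0..r} s * (ennreal (exp (- r)) * ?h r * indicator {0..} r) \<partial>lborel)"
      proof (intro nn_integral_cong)
        fix r :: real
        \<comment> \<open>The weight splits into a function of \<open>s\<close> and a function of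
          \<open>r\<close>. After the integrals are exchanged, the one over \<open>s\<close> in
          \<open>{0..r}\<close> is therefore explicit.\<close>
        have "exp (- (1 + \<alpha>) * s) * exp (s - r) = exp (- \<alpha> * s) * exp (- r)"
          by (simp add: exp_add[symmetric] algebra_simps)
        then have "ennreal (exp (- (1 + \<alpha>) * s)) * ennreal (exp (s - r)) = ennreal (exp (- \<alpha> * s)) * ennreal (exp (- r))"
          by (simp add: ennreal_mult'[symmetric])
        then show "ennreal (exp (- (1 + \<alpha>) * s)) * (ennreal (exp (s - r)) * ?h r * indicator {s..} r)
            = ennreal (exp (- \<alpha> * s)) * indicator {0..r} s * (ennreal (exp (- r)) * ?h r * indicator {0..} r)"
          using True by (auto simp: indicator_def mult.assoc[symmetric])
      qed
      finally show ?thesis .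
    qed (simp add: indicator_def)
  qed
  also have "\<dots> = (\<integral>\<^sup>+r. \<integral>\<^sup>+s. ennreal (exp (- \<alpha> * s)) * indicator {0..r} s * (ennreal (exp (- r)) * ?h r * indicator {0..} r) \<partial>lborel \<partial>lborel)"
    by (rule lborel_pair.Fubini') (rule joint)
  finally have "ennreal \<alpha> * RU (1 + \<alpha>) (RU 1 F) \<eta> = ennreal \<alpha> * (\<integral>\<^sup>+r. \<integral>\<^sup>+s. ennreal (exp (- \<alpha> * s)) * indicator {0..r} s * (ennreal (exp (- r)) * ?h r * indicator {0..} r) \<partial>lborel \<partial>lborel)"
    by (rule arg_cong)
  also have "\<dots> = (\<integral>\<^sup>+r. ennreal \<alpha> * (\<integral>\<^sup>+s. ennreal (exp (- \<alpha> * s)) * indicator {0..r} s * (ennreal (exp (- r)) * ?h r * indicator {0..} r) \<partial>lborel) \<partial>lborel)"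
    by (rule nn_integral_cmult[symmetric]) (rule lborel.borel_measurable_nn_integral[OF joint])
  also have "\<dots> = (\<integral>\<^sup>+r. ennreal \<alpha> * (\<integral>\<^sup>+s. ennreal (exp (- \<alpha> * s)) * indicator {0..r} s \<partial>lborel) * (ennreal (exp (- r)) * ?h r * indicator {0..} r) \<partial>lborel)"
  proof (intro nn_integral_cong)
    fix r :: real
    have "(\<lambda>s. ennreal (exp (- \<alpha> * s)) * indicator {0..r} s) \<in> borel_measurable lborel"
      by simp
    from nn_integral_multc[OF this, of "ennreal (exp (- r)) * ?h r * indicator {0..} r"]
    show "ennreal \<alpha> * (\<integral>\<^sup>+s. ennreal (exp (- \<alpha> * s)) * indicator {0..r} s * (ennreal (exp (- r)) * ?h r * indicator {0..} r) \<partial>lborel)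
        = ennreal \<alpha> * (\<integral>\<^sup>+s. ennreal (exp (- \<alpha> * s)) * indicator {0..r} s \<partial>lborel) * (ennreal (exp (- r)) * ?h r * indicator {0..} r)"
      by (simp only: mult.assoc)
  qed
  also have "\<dots> = (\<integral>\<^sup>+r\<in>{0..}. (ennreal (1 - exp (- \<alpha> * r)) * (ennreal (exp (- r)) * ?h r)) \<partial>lborel)"
  proof (intro nn_integral_cong)
    fix r :: real
    show "ennreal \<alpha> * (\<integral>\<^sup>+s. ennreal (exp (- \<alpha> * s)) * indicator {0..r} s \<partial>lborel) * (ennreal (exp (- r)) * ?h r * indicator {0..} r)
        = ennreal (1 - exp (- \<alpha> * r)) * (ennreal (exp (- r)) * ?h r) * indicator {0..} r"
      using nn_integral_exp_truncated[OF \<alpha>, of r] by (auto simp: indicator_def)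
  qed
  finally show ?thesis .
qed

section \<open>Excessiveness of potentials\<close>

text \<open>\<open>RU_RU\<close> expresses the iterated resolvent through the weights
  \<open>1 - exp (- \<alpha> * r)\<close>. They stay below 1, which gives the inequality, and
  increase to 1 for \<open>r > 0\<close>, which gives the limit by monotone convergence. Infinite
  values of \<open>F\<close> are allowed.\<close>

lemma excessive_RU:
  assumes F [measurable]: "F \<in> borel_measurable S"
  shows "excessive \<mu> 1 (\<lambda>y. RU 1 F (Lam (y - z)))"
  unfolding excessive_def
proof (intro conjI allI impI)
  have c: "continuous_on UNIV (\<lambda>y. L k (y - z))" for k
    by (intro continuous_on_compose2[OF continuous_L] continuous_intros) auto
  show "(\<lambda>y. RU 1 F (Lam (y - z))) \<in> borel_measurable borel"
    unfolding Lam_def using c[THEN borel_measurable_continuous_onI] by measurable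
  fix y
  define \<eta> where "\<eta> = Lam (y - z)"
  define I where "I \<alpha> = (\<integral>\<^sup>+r\<in>{0..}. (ennreal (1 - exp (- \<alpha> * r)) * (ennreal (exp (- r)) * PS r F \<eta>)) \<partial>lborel)" for \<alpha>
  have I: "ennreal \<alpha> * resolvent_U \<mu> (1 + \<alpha>) (\<lambda>y. RU 1 F (Lam (y - z))) y = I \<alpha>" if "0 < \<alpha>" for \<alpha>
    using RU_RU[OF F that, of \<eta>] by (simp add: resolvent_U_eq_RU I_def \<eta>_def)
  have I_mono: "I \<alpha> \<le> I \<beta>" if "\<alpha> \<le> \<beta>" for \<alpha> \<beta>
    unfolding I_def using that
    by (intro nn_integral_mono) (auto simp: indicator_def intro!: mult_right_mono ennreal_leI)
  have V: "RU 1 F \<eta> = (\<integral>\<^sup>+r\<in>{0..}. (ennreal (exp (- r)) * PS r F \<eta>) \<partial>lborel)"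
    by (simp add: RU_def)
  have I_le: "I \<alpha> \<le> RU 1 F \<eta>" for \<alpha>
  proof -
    have "ennreal (1 - exp (- \<alpha> * r)) * c \<le> c" for r c
      using mult_right_mono[of "ennreal (1 - exp (- \<alpha> * r))" 1 c] by simp
    then show ?thesis
      unfolding V I_def by (intro nn_integral_mono mult_right_mono) auto
  qed
  show "ennreal \<alpha> * resolvent_U \<mu> (1 + \<alpha>) (\<lambda>y. RU 1 F (Lam (y - z))) y \<le> RU 1 F (Lam (y - z))" if "0 < \<alpha>" for \<alpha>
    using I[OF that] I_le by (simp add: \<eta>_def)
  have "RU 1 F \<eta> = (\<integral>\<^sup>+r. (SUP n. ennreal (1 - exp (- real n * r)) * (ennreal (exp (- r)) * PS r F \<eta>) * indicator {0..} r) \<partial>lborel)"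
    unfolding V
  proof (rule nn_integral_cong_AE)
    \<comment> \<open>At \<open>r = 0\<close> all weights vanish, so the supremum can differ from
      the integrand there; a single point is a null set.\<close>
    show "AE r in lborel. ennreal (exp (- r)) * PS r F \<eta> * indicator {0..} r
        = (SUP n. ennreal (1 - exp (- real n * r)) * (ennreal (exp (- r)) * PS r F \<eta>) * indicator {0..} r)"
      using AE_lborel_singleton[of 0]
    proof eventually_elim
      case (elim r)
      show ?case
      proof (cases "0 < r")
        case True
        then show ?thesis
          using SUP_one_minus_exp[OF True] SUP_mult_right_ennreal[of "\<lambda>n. ennreal (1 - exp (- (real n * r)))" UNIV "ennreal (exp (- r)) * PS r F \<eta>"]
          by simp
      qed (use elim in auto)
    qed
  qed
  also have "\<dots> = (SUP n. I (real n))"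
    unfolding I_def
    by (rule nn_integral_monotone_convergence_SUP)
      (auto simp: incseq_Suc_iff le_fun_def indicator_def algebra_simps intro!: mult_left_mono mult_right_mono ennreal_leI)
  finally have SUP: "RU 1 F \<eta> = (SUP n. I (real n))" .
  \<comment> \<open>\<open>I\<close> is monotone in its real argument, so the supremum over the
    natural numbers is also the limit along the reals.\<close>
  have "(I \<longlongrightarrow> RU 1 F \<eta>) at_top"
  proof (rule order_tendstoI)
    fix a assume "a < RU 1 F \<eta>"
    then obtain n where n: "a < I (real n)"
      unfolding SUP less_SUP_iff by auto
    show "eventually (\<lambda>\<alpha>. a < I \<alpha>) at_top"
      using eventually_ge_at_top[of "real n"] by eventually_elim (rule less_le_trans[OF n I_mono])
  next
    fix a assume "RU 1 F \<eta> < a"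
    then show "eventually (\<lambda>\<alpha>. I \<alpha> < a) at_top"
      by (intro always_eventually allI) (rule le_less_trans[OF I_le])
  qed
  moreover have "eventually (\<lambda>\<alpha>. I \<alpha> = ennreal \<alpha> * resolvent_U \<mu> (1 + \<alpha>) (\<lambda>y. RU 1 F (Lam (y - z))) y) at_top"
    using eventually_gt_at_top[of 0] by eventually_elim (simp add: I)
  ultimately show "((\<lambda>\<alpha>. ennreal \<alpha> * resolvent_U \<mu> (1 + \<alpha>) (\<lambda>y. RU 1 F (Lam (y - z))) y) \<longlongrightarrow> RU 1 F (Lam (y - z))) at_top"
    unfolding \<eta>_def[symmetric] by (rule Lim_transform_eventually)
qed

section \<open>Comparison of \<open>G\<close> with its potential\<close>

text \<open>The exponential density has mass and mean 1. This converts bounds that are affine in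
  \<open>t\<close> for the semigroup into bounds for the resolvent.\<close>

lemma nn_integral_exp_affine:
  "(\<integral>\<^sup>+t\<in>{0..}. (ennreal (exp (- t)) * (a + ennreal (2 * t) * b)) \<partial>lborel) = a + 2 * b"
proof -
  have *: "(\<integral>\<^sup>+t. ennreal (exp (- t)) * indicator {0..} t \<partial>lborel) = 1"
    "(\<integral>\<^sup>+t. ennreal (t * exp (- t)) * indicator {0..} t \<partial>lborel) = 1"
    using nn_intergal_power_times_exp_Ici[of 0] nn_intergal_power_times_exp_Ici[of 1]
    by (simp_all add: nn_integral_set_ennreal)
  have "(\<integral>\<^sup>+t\<in>{0..}. (ennreal (exp (- t)) * (a + ennreal (2 * t) * b)) \<partial>lborel)
      = (\<integral>\<^sup>+t. a * (ennreal (exp (- t)) * indicator {0..} t) + 2 * b * (ennreal (t * exp (- t)) * indicator {0..} t) \<partial>lborel)"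
    by (intro nn_integral_cong) (auto simp: indicator_def ennreal_mult distrib_left mult_ac)
  also have "\<dots> = a + 2 * b"
    by (simp add: nn_integral_add nn_integral_cmult *)
  finally show ?thesis .
qed

lemma PS_G_le: "0 \<le> t \<Longrightarrow> PS t G \<eta> \<le> 2 * G \<eta> + ennreal (2 * t) * mean_G"
proof -
  assume t: "0 \<le> t"
  have "PS t G \<eta> \<le> (\<integral>\<^sup>+w. 2 * G \<eta> + ennreal (2 * t) * G (Lam w) \<partial>\<mu>)"
    unfolding PS_def using G_add_le[of \<eta> "sqrt t"] t by (intro nn_integral_mono) (simp add: Lam_def[abs_def])
  also have "\<dots> = 2 * G \<eta> + ennreal (2 * t) * mean_G"
    using emeasure_space_1 by (simp add: nn_integral_add nn_integral_cmult mean_G_def)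
  finally show ?thesis .
qed

text \<open>Undoing the displacement, that is \<open>G_add_le\<close> with
  \<open>a = - sqrt t\<close> at the displaced point, bounds \<open>G\<close> at
  \<open>\<eta>\<close> by an integrand in \<open>w\<close>.\<close>

lemma G_le_PS: "0 \<le> t \<Longrightarrow> G \<eta> \<le> 2 * PS t G \<eta> + ennreal (2 * t) * mean_G"
proof -
  assume t: "0 \<le> t"
  have "G \<eta> = (\<integral>\<^sup>+w. G \<eta> \<partial>\<mu>)"
    using emeasure_space_1 by simp
  also have "\<dots> \<le> (\<integral>\<^sup>+w. 2 * G (\<lambda>k. \<eta> k + sqrt t * L k w) + ennreal (2 * t) * G (Lam w) \<partial>\<mu>)"
  proof (intro nn_integral_mono)
    fix w
    show "G \<eta> \<le> 2 * G (\<lambda>k. \<eta> k + sqrt t * L k w) + ennreal (2 * t) * G (Lam w)"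
      using G_add_le[of "\<lambda>k. \<eta> k + sqrt t * L k w" "- sqrt t" "Lam w"] t by (simp add: Lam_def)
  qed
  also have "\<dots> = 2 * PS t G \<eta> + ennreal (2 * t) * mean_G"
    by (simp add: nn_integral_add nn_integral_cmult mean_G_def PS_def)
  finally show ?thesis .
qed

lemma RU_G_le: "RU 1 G \<eta> \<le> 2 * G \<eta> + 2 * mean_G"
proof -
  have "RU 1 G \<eta> \<le> (\<integral>\<^sup>+t\<in>{0..}. (ennreal (exp (- t)) * (2 * G \<eta> + ennreal (2 * t) * mean_G)) \<partial>lborel)"
    unfolding RU_def by (intro nn_integral_mono) (auto simp: indicator_def intro!: mult_left_mono PS_G_le)
  then show ?thesis unfolding nn_integral_exp_affine .
qed

lemma G_le_RU: "G \<eta> \<le> 2 * RU 1 G \<eta> + 2 * mean_G"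
proof -
  have "G \<eta> = (\<integral>\<^sup>+t\<in>{0..}. (ennreal (exp (- t)) * G \<eta>) \<partial>lborel)"
    using nn_integral_exp_affine[of "G \<eta>" 0] by simp
  also have "\<dots> \<le> (\<integral>\<^sup>+t\<in>{0..}. (ennreal (exp (- t)) * (2 * PS t G \<eta> + ennreal (2 * t) * mean_G)) \<partial>lborel)"
    by (intro nn_integral_mono) (auto simp: indicator_def intro!: mult_left_mono G_le_PS)
  also have "\<dots> = (\<integral>\<^sup>+t. 2 * (ennreal (exp (- t)) * PS t G \<eta> * indicator {0..} t)
      + ennreal (exp (- t)) * (0 + ennreal (2 * t) * mean_G) * indicator {0..} t \<partial>lborel)"
    by (intro nn_integral_cong) (auto simp: indicator_def distrib_left mult_ac)
  also have "\<dots> = 2 * RU 1 G \<eta> + (0 + 2 * mean_G)"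
    unfolding nn_integral_exp_affine[symmetric] RU_def by (simp add: nn_integral_add nn_integral_cmult)
  finally show ?thesis by simp
qed

lemma RU_G_finite_iff: "RU 1 G \<eta> < \<infinity> \<longleftrightarrow> G \<eta> < \<infinity>"
  using RU_G_le[of \<eta>] G_le_RU[of \<eta>] mean_G_finite
  by (auto simp: ennreal_mult_less_top intro: le_less_trans)

lemma compact_lyapunov_RU_G: "compact_lyapunov \<mu> 1 (\<lambda>y. RU 1 G (Lam (y - z)))"
  unfolding compact_lyapunov_def
proof (intro conjI allI impI)
  show "excessive \<mu> 1 (\<lambda>y. RU 1 G (Lam (y - z)))"
    by (rule excessive_RU) measurable
  fix \<alpha> :: real assume "0 < \<alpha>"
  \<comment> \<open>By \<open>G_le_RU\<close>, \<open>G\<close> is at most this level on the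
    translated sublevel set; \<open>enn2real\<close> loses nothing because \<open>mean_G\<close> is
    finite.\<close>
  define \<beta> where "\<beta> = 2 * \<alpha> + 2 * enn2real mean_G"
  have \<beta>: "0 < \<beta>" using \<open>0 < \<alpha>\<close> by (simp add: \<beta>_def add_pos_nonneg)
  have eq: "ennreal \<beta> = 2 * ennreal \<alpha> + 2 * mean_G"
    using \<open>0 < \<alpha>\<close> mean_G_finite by (simp add: \<beta>_def ennreal_plus ennreal_mult ennreal_enn2real)
  have "{y. RU 1 G (Lam (y - z)) \<le> ennreal \<alpha>} \<subseteq> (+) z ` {y. G (Lam y) \<le> ennreal \<beta>}"
  proof clarify
    fix y assume "RU 1 G (Lam (y - z)) \<le> ennreal \<alpha>"
    then have "2 * RU 1 G (Lam (y - z)) + 2 * mean_G \<le> ennreal \<beta>"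
      unfolding eq by (intro add_mono mult_left_mono) auto
    then have "G (Lam (y - z)) \<le> ennreal \<beta>"
      using G_le_RU order_trans by blast
    then show "y \<in> (+) z ` {y. G (Lam y) \<le> ennreal \<beta>}"
      by (intro image_eqI[of _ _ "y - z"]) auto
  qed
  then have "closure {y. RU 1 G (Lam (y - z)) \<le> ennreal \<alpha>} \<subseteq> (+) z ` closure {y. G (Lam y) \<le> ennreal \<beta>}"
    unfolding closure_translation[symmetric] by (rule closure_mono)
  moreover have "compact ((+) z ` closure {y. G (Lam y) \<le> ennreal \<beta>})"
    by (intro compact_translation compact_closure_sublevel_G \<beta>)
  ultimately show "compact (closure {y. RU 1 G (Lam (y - z)) \<le> ennreal \<alpha>})"
    by (metis closed_closure compact_Int_closed inf.absorb_iff2)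
qed

section \<open>Invariance\<close>

text \<open>By \<open>G_add_le\<close> the points where \<open>G\<close> is finite are stable under
  adding multiples of one another, and \<open>mean_G_finite\<close> puts almost every
  \<open>w\<close> among them. Almost every displacement thus leaves membership unchanged in both
  directions.\<close>

lemma semigroup_P_invariant:
  assumes "0 < t"
  shows "semigroup_P \<mu> t (indicator {y. G (Lam (y - z)) < \<infinity>}) = indicator {y. G (Lam (y - z)) < \<infinity>}"
proof
  fix y
  let ?B = "{\<eta>. G \<eta> < \<infinity>}"
  have B: "indicator ?B \<in> borel_measurable S"
    using measurable_sets[OF measurable_G, of "{..<\<infinity>}"] by (simp add: vimage_def space_PiM)
  have ind: "indicator {y. G (Lam (y - z)) < \<infinity>} = (\<lambda>y. indicator ?B (Lam (y - z)) :: ennreal)"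
    by (simp add: fun_eq_iff indicator_def)
  define \<eta> where "\<eta> = Lam (y - z)"
  have "AE w in \<mu>. G (Lam w) \<noteq> \<infinity>"
    using mean_G_finite unfolding mean_G_def by (intro nn_integral_noteq_infinite) auto
  then have "AE w in \<mu>. (indicator ?B (\<lambda>k. \<eta> k + sqrt t * L k w) :: ennreal) = indicator ?B \<eta>"
  proof eventually_elim
    case (elim w)
    have "G (\<lambda>k. \<eta> k + sqrt t * L k w) < \<infinity>" if "G \<eta> < \<infinity>"
      using G_add_le[of \<eta> "sqrt t" "Lam w"] that elim
      by (auto simp: Lam_def[symmetric] ennreal_mult_less_top less_top intro: le_less_trans)
    moreover have "G \<eta> < \<infinity>" if "G (\<lambda>k. \<eta> k + sqrt t * L k w) < \<infinity>"
    proof -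
      have "G \<eta> \<le> 2 * G (\<lambda>k. \<eta> k + sqrt t * L k w) + ennreal (2 * (- sqrt t)\<^sup>2) * G (Lam w)"
        using G_add_le[of "\<lambda>k. \<eta> k + sqrt t * L k w" "- sqrt t" "Lam w"] by (simp add: Lam_def)
      also have "\<dots> < \<infinity>"
        using that elim by (auto simp: ennreal_mult_less_top less_top)
      finally show ?thesis .
    qed
    ultimately show ?case by (auto simp: indicator_def)
  qed
  then have "PS t (indicator ?B) \<eta> = (\<integral>\<^sup>+w. indicator ?B \<eta> \<partial>\<mu>)"
    unfolding PS_def by (rule nn_integral_cong_AE)
  also have "\<dots> = indicator ?B \<eta>"
    using emeasure_space_1 by simp
  finally show "semigroup_P \<mu> t (indicator {y. G (Lam (y - z)) < \<infinity>}) y = indicator {y. G (Lam (y - z)) < \<infinity>} y"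
    unfolding ind using semigroup_P_eq_PS[OF B, of t z y] assms by (simp add: \<eta>_def)
qed

end

section \<open>Transfer to the notation of the statement\<close>

theorem theorem2p7:
  fixes \<mu> :: "'e::banach measure"
    and j :: "'h::{real_inner, polish_space} \<Rightarrow> 'e"
    and x :: 'e
    and e :: "nat \<Rightarrow> 'h"
    and l :: "nat \<Rightarrow> 'e \<Rightarrow> real"
    and \<sigma> :: "nat \<Rightarrow> nat"
    and Q :: "nat \<Rightarrow> 'e \<Rightarrow> 'h"
  assumes wiener: "abstract_wiener_space \<mu> j"
    and x_notin_H: "x \<notin> range j"
    and orthonormal: "\<And>m n. 1 \<le> m \<Longrightarrow> 1 \<le> n \<Longrightarrow> e m \<bullet> e n = (if m = n then 1 else 0)"
    and basis: "closure (span (e ` {1..})) = UNIV"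
    and basis_in_dual: "\<And>n. 1 \<le> n \<Longrightarrow> riesz_rep j (l n) (e n)"
    and separates: "\<And>z w. (\<And>n. 1 \<le> n \<Longrightarrow> l n z = l n w) \<Longrightarrow> z = w"
    and growth: "\<And>n. 1 \<le> n \<Longrightarrow> l n x \<ge> 2 powr (real n / 2)"
    and subsequence: "strict_mono_on {1..} \<sigma>" "\<And>n. 1 \<le> n \<Longrightarrow> 1 \<le> \<sigma> n"
    and Q_zero: "Q 0 = (\<lambda>z. 0)"
    and Q_pos: "\<And>n. 1 \<le> n \<Longrightarrow> Q n = proj_P e l (\<sigma> n)"
    and Q_onorm: "\<And>n. 1 \<le> n \<Longrightarrow> onorm (\<lambda>h. j (h - Q n (j h))) \<le> (1 / 2) ^ n"
    and Q_prob: "\<And>n. 1 \<le> n \<Longrightarrow> measure \<mu> {z. norm (z - j (Q n z)) > (1 / 2) ^ n} \<le> (1 / 2) ^ n"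
  shows "\<forall>z. compact_lyapunov \<mu> 1 (v_fun \<mu> j l Q z)
           \<and> translation z ` E_fin j l Q = {y. v_fun \<mu> j l Q z y < \<infinity>}
           \<and> (\<forall>t>0. semigroup_P \<mu> t (indicator (translation z ` E_fin j l Q))
                     = indicator (translation z ` E_fin j l Q))"
proof -
  \<comment> \<open>The hypotheses constrain \<open>\<sigma>\<close> only from index 1 on; the value
    at 0 is chosen to match \<open>Q_zero\<close>.\<close>
  define N where "N n = (if n = 0 then 0 else \<sigma> n)" for n
  have proj: "proj_P e l m y = (\<Sum>k<m. l (Suc k) y *\<^sub>R e (Suc k))" for m y
    unfolding proj_P_def by (simp add: sum.atLeast1_atMost_eq)
  have Q: "Q n y = (\<Sum>k<N n. l (Suc k) y *\<^sub>R e (Suc k))" for n y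
    using Q_zero Q_pos[of n] by (cases "n = 0") (auto simp: N_def proj)
  interpret wiener_basis \<mu> j "\<lambda>k. e (Suc k)" "\<lambda>k. l (Suc k)" N
  proof (intro wiener_basis.intro wiener wiener_basis_axioms.intro)
    show "e (Suc i) \<bullet> e (Suc k) = (if i = k then 1 else 0)" for i k
      using orthonormal[of "Suc i" "Suc k"] by simp
    show "riesz_rep j (l (Suc k)) (e (Suc k))" for k
      using basis_in_dual by simp
    show "y = w" if "\<And>k. l (Suc k) y = l (Suc k) w" for y w
      using that by (intro separates) (metis Suc_le_D One_nat_def)
    show "N 0 = 0" by (simp add: N_def)
    show "strict_mono N"
      unfolding strict_mono_Suc_iff
    proof
      fix n
      show "N n < N (Suc n)"
        using subsequence(2)[of "Suc n"] strict_mono_onD[OF subsequence(1), of n "Suc n"]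
        by (cases "n = 0") (auto simp: N_def)
    qed
    show "measure \<mu> {z. norm (z - j (\<Sum>k<N n. l (Suc k) z *\<^sub>R e (Suc k))) > (1 / 2) ^ n} \<le> (1 / 2) ^ n" if "1 \<le> n" for n
      using Q_prob[OF that] by (simp add: Q)
  qed
  have q_eq: "(q_fun j l Q y)\<^sup>2 = G (Lam y)" for y
    unfolding q_fun_def ennreal_sqrt_power2 G_def D_def T_def Lam_def dyadic_weight_def Q ..
  have E_fin_eq: "E_fin j l Q = {y. G (Lam y) < \<infinity>}"
    by (auto simp: E_fin_def q_eq[symmetric] power_less_top_ennreal)
  have inv: "inv (translation z) = (\<lambda>y. y - z)" for z :: 'e
    by (intro inv_equality) (simp_all add: translation_def)
  have v_eq: "v_fun \<mu> j l Q z = (\<lambda>y. RU 1 G (Lam (y - z)))" for z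
  proof
    fix y
    show "v_fun \<mu> j l Q z y = RU 1 G (Lam (y - z))"
      \<comment> \<open>In \<open>v_fun\<close> the translation acts after the resolvent, so the
        identity is used with shift 0 at the point \<open>y - z\<close>.\<close>
      using resolvent_U_eq_RU[OF measurable_G, of 1 0 "y - z"]
      by (simp add: v_fun_def inv q_eq)
  qed
  have E_eq: "translation z ` E_fin j l Q = {y. G (Lam (y - z)) < \<infinity>}" for z
  proof -
    have "y \<in> translation z ` E_fin j l Q" if "G (Lam (y - z)) < \<infinity>" for y
      using that by (intro image_eqI[of _ _ "y - z"]) (simp_all add: translation_def E_fin_eq)
    then show ?thesis by (auto simp: translation_def E_fin_eq)
  qed
  show ?thesis
    unfolding v_eq E_eq RU_G_finite_iff
    using compact_lyapunov_RU_G semigroup_P_invariant by simp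
qed

end
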